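(* Let $N\ge 2$ and let $A=(a_1,\ldots,a_N)$, $B=(b_1,\ldots,b_N)\in\mathbb{R}^N$ be two nonnegative vectors. Put $a=a_1+\cdots+a_N$, $b=b_1+\cdots+b_N$, $\overline{a}_i=a-a_i$ and $\overline{b}_i=b-b_i$. Let $C_{A,B,N}$ be the isoperimetric constant defined in the context. (I) If $C_{A,B,N}>0$, then for every $i\in\{1,\ldots,N\}$ $$0\le a_i-\frac{N+a-1}{N+b}\,b_i\le \frac{N+a-1}{N+b},\qquad ( * )$$ or, equivalently, for every $i\in\{1,\ldots,N\}$ $$0\le a_i-\frac{N+\overline{a}_i-1}{N+\overline{b}_i}\,b_i\quad\text{and}\quad \frac{a_i}{b_i+1}\le\frac{N+\overline{a}_i-1}{N+\overline{b}_i-1}.$$ (II) If $a-b\le 1$ and condition $( * )$ holds for every $i\in\{1,\ldots,N\}$, then $C_{A,B,N}>0$.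
   Context: A vector in $\mathbb{R}^N$ is called nonnegative if all its entries are nonnegative. For a nonnegative vector $A=(a_1,\ldots,a_N)$ and $x\in\mathbb{R}^N$, the monomial weight is $x^A:=|x_1|^{a_1}\cdots|x_N|^{a_N}$ (a factor with exponent $0$ is equal to $1$). With $a=a_1+\cdots+a_N$ and $b=b_1+\cdots+b_N$, define $$C_{A,B,N}:=\inf\left\{\frac{\int_{\partial\Omega}x^{A}\,d\mathcal{H}^{N-1}(x)}{\left[\int_{\Omega}x^{B}\,dx\right]^{\frac{N+a-1}{N+b}}}\;:\;\Omega\subset\mathbb{R}^N\text{ is a smooth open set and }0<\int_{\Omega}x^{B}\,dx<\infty\right\}\in[0,+\infty),$$ where $\mathcal{H}^{N-1}$ is the $(N-1)$-dimensional Hausdorff measure. *)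

theory Defs
  imports "HOL-Analysis.Analysis"
begin

(* The case distinction is needed because 0 powr 0 = 0 in Isabelle/HOL. *)
definition monomial_weight :: "real ^ 'n \<Rightarrow> real ^ 'n \<Rightarrow> real" where
  "monomial_weight A x = (\<Prod>i\<in>UNIV. if A $ i = 0 then 1 else \<bar>x $ i\<bar> powr (A $ i))"


(* The library function diameter is only meaningful on bounded sets, hence the
   restriction to bounded covering sets. The empty set is treated separately so that
   the definition gives the counting measure for d = 0, where 0 ^ 0 = 1. The factor
   unit_ball_vol d is the usual normalization making the d-dimensional measure
   agree with the Lebesgue measure on d-dimensional space. *)
definition hausdorff_gauge :: "nat \<Rightarrow> 'a::metric_space set \<Rightarrow> ennreal" where
  "hausdorff_gauge d S =
     (if S = {} then 0 else ennreal (unit_ball_vol (real d) * (diameter S / 2) ^ d))"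

definition hausdorff_premeasure :: "nat \<Rightarrow> real \<Rightarrow> 'a::metric_space set \<Rightarrow> ennreal" where
  "hausdorff_premeasure d \<delta> E =
     (INF C\<in>{C :: nat \<Rightarrow> 'a set. (\<forall>n. bounded (C n) \<and> diameter (C n) \<le> \<delta>) \<and> E \<subseteq> (\<Union>n. C n)}.
        \<Sum>n. hausdorff_gauge d (C n))"

definition hausdorff_outer :: "nat \<Rightarrow> 'a::metric_space set \<Rightarrow> ennreal" where
  "hausdorff_outer d E = (SUP \<delta>\<in>{0<..}. hausdorff_premeasure d \<delta> E)"

(* measure_of yields the null measure if its last argument is not countably additive on
   the given sigma-algebra; the Hausdorff outer measure is a metric outer measure and
   therefore is countably additive on the Borel sets. *)
definition hausdorff_measure :: "nat \<Rightarrow> 'a::metric_space measure" where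
  "hausdorff_measure d = measure_of UNIV (sets borel) (hausdorff_outer d)"


(* Ck_on k f U is meant for open U. *)
primrec Ck_on :: "nat \<Rightarrow> ('a::euclidean_space \<Rightarrow> real) \<Rightarrow> 'a set \<Rightarrow> bool" where
  "Ck_on 0 f U \<longleftrightarrow> continuous_on U f"
| "Ck_on (Suc k) f U \<longleftrightarrow>
     (\<forall>x\<in>U. f differentiable (at x)) \<and>
     (\<forall>e\<in>Basis. Ck_on k (\<lambda>x. frechet_derivative f (at x) e) U)"

definition smooth_on :: "('a::euclidean_space \<Rightarrow> real) \<Rightarrow> 'a set \<Rightarrow> bool" where
  "smooth_on f U \<longleftrightarrow> (\<forall>k. Ck_on k f U)"

(* Open sets with smooth boundary, lying locally on one side of it; neither boundedness
   nor connectedness is required. *)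
definition smooth_open_set :: "'a::euclidean_space set \<Rightarrow> bool" where
  "smooth_open_set \<Omega> \<longleftrightarrow> open \<Omega> \<and>
     (\<forall>p\<in>frontier \<Omega>. \<exists>U \<phi>. open U \<and> p \<in> U \<and> smooth_on \<phi> U \<and>
        (\<forall>x\<in>U. frechet_derivative \<phi> (at x) \<noteq> (\<lambda>v. 0)) \<and>
        \<Omega> \<inter> U = {x \<in> U. \<phi> x < 0})"


definition weighted_volume :: "real ^ 'n \<Rightarrow> (real ^ 'n) set \<Rightarrow> ennreal" where
  "weighted_volume B \<Omega> = (\<integral>\<^sup>+ x\<in>\<Omega>. ennreal (monomial_weight B x) \<partial>lborel)"

definition weighted_perimeter :: "real ^ 'n \<Rightarrow> (real ^ 'n) set \<Rightarrow> ennreal" where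
  "weighted_perimeter A \<Omega> =
     (\<integral>\<^sup>+ x\<in>frontier \<Omega>. ennreal (monomial_weight A x) \<partial>hausdorff_measure (CARD('n) - 1))"

definition iso_exponent :: "real ^ 'n \<Rightarrow> real ^ 'n \<Rightarrow> real" where
  "iso_exponent A B =
     (real CARD('n) + (\<Sum>i\<in>UNIV. A $ i) - 1) / (real CARD('n) + (\<Sum>i\<in>UNIV. B $ i))"

(* The perimeter may be infinite for an admissible set, so the infimum is taken over
   extended nonnegative quotients. *)
definition iso_constant :: "real ^ 'n \<Rightarrow> real ^ 'n \<Rightarrow> ennreal" where
  "iso_constant A B =
     (INF \<Omega>\<in>{\<Omega>. smooth_open_set \<Omega> \<and> 0 < weighted_volume B \<Omega> \<and> weighted_volume B \<Omega> < \<infinity>}.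
        weighted_perimeter A \<Omega> /
        ennreal (enn2real (weighted_volume B \<Omega>) powr iso_exponent A B))"

end

theory Submission
  imports Defs
begin

text \<open>
  Write \<open>r = (N+a-1)/(N+b)\<close> for the exponent of the isoperimetric quotient and
  \<open>\<tau>\<^sub>i = a\<^sub>i - rb\<^sub>i\<close>, so that the condition reads \<open>0 \<le> \<tau>\<^sub>i \<le> r\<close>.

  Necessity. The ellipsoid centred at distance t on the i-th axis, with semiaxis \<open>\<epsilon>\<close> in direction i
  and semiaxes 1 otherwise, has quotient at most a constant times \<open>(t+\<epsilon>)\<close> to the power \<open>\<tau>\<^sub>i\<close>,
  times \<open>\<epsilon>\<close> to the power \<open>-r\<close> (\<open>iso_constant_le_ellipsoid\<close>). If \<open>\<tau>\<^sub>i < 0\<close>, it tends to 0 for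
  \<open>\<epsilon> = 1\<close> and t to infinity, and if \<open>\<tau>\<^sub>i > r\<close>, for \<open>t = 0\<close> and \<open>\<epsilon>\<close> to 0. The perimeter estimate
  uses that the unit sphere has finite Hausdorff measure and that these ellipsoids are images
  of the ball under maps that do not increase distances.

  Sufficiency. Let \<open>g = x\<^sup>A\<close>, let P and V be the weighted perimeter and volume of \<open>\<Omega>\<close>, and let
  \<open>G\<^sub>i\<close> be the supremum of g over the fibres of \<open>\<Omega>\<close> in direction i, a function of the other N-1
  coordinates. Three facts suffice:

  \<^item> \<open>\<integral>G\<^sub>i \<le> KP\<close> (\<open>nn_integral_fibre_sup_le\<close>). Since V is finite, almost every fibre leaves \<open>\<Omega>\<close>
    further out, where g is at least as large. So, up to null sets, the superlevel sets of \<open>G\<^sub>i\<close> are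
    contained in projections of superlevel sets of g on the boundary, and up to a constant the
    Hausdorff measure of a set dominates the Lebesgue measure of its projections.

  \<^item> \<open>\<integral>\<^sub>\<Omega> g/|x\<^sub>k| \<le> (2/a\<^sub>k) \<integral>G\<^sub>k\<close> if \<open>a\<^sub>k > 0\<close> (\<open>nn_integral_fibre_Hardy\<close>), by integrating along the
    fibres.

  \<^item> A Loomis--Whitney inequality for products of powers of functions that depend on some of the
    coordinates only, provided that for each coordinate the exponents of the functions that depend
    on it sum to 1 (\<open>Finner_inequality\<close>).

  The exponents of the variables in g and in the weight \<open>x\<^sup>B\<close> match: on \<open>\<Omega>\<close>, the weight \<open>x\<^sup>B\<close> is at
  most the product of the functions \<open>G\<^sub>i\<close> with exponents \<open>(1-r)/r\<close> and the functions \<open>g/|x\<^sub>k|\<close> with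
  exponents \<open>\<tau>\<^sub>k/r\<close>. These are nonnegative because \<open>\<tau>\<^sub>k \<ge> 0\<close> and, by \<open>a - b \<le> 1\<close>, also \<open>r \<le> 1\<close>.
  As the \<open>\<tau>\<^sub>k\<close> sum to \<open>1 - N(1-r)\<close>, the exponents at each coordinate sum to
  \<open>(N-1)(1-r)/r + (1 - N(1-r))/r = 1\<close>, and all of them sum to \<open>1/r\<close>. Integrating the product,
  V is at most \<open>(KP)\<close> to the power \<open>1/r\<close>, with K independent of \<open>\<Omega>\<close>. If \<open>r = 1\<close>, only
  the Hardy terms are present; if \<open>r = (N-1)/N\<close> only the Loomis--Whitney terms.

  Integrals with respect to the Hausdorff measure make sense because the Hausdorff outer measure is
  additive on separated sets, hence a measure on the Borel sets
  (\<open>emeasure_hausdorff_measure\<close>).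
\<close>

section \<open>Hausdorff measure\<close>

lemma hausdorff_gauge_empty [simp]: "hausdorff_gauge d {} = 0"
  by (simp add: hausdorff_gauge_def)

lemma hausdorff_premeasure_le_cover:
  assumes "\<And>n::nat. bounded (C n)" "\<And>n. diameter (C n) \<le> \<delta>" "E \<subseteq> (\<Union>n. C n)"
  shows "hausdorff_premeasure d \<delta> E \<le> (\<Sum>n. hausdorff_gauge d (C n))"
  unfolding hausdorff_premeasure_def by (rule INF_lower) (use assms in auto)

lemma hausdorff_premeasure_empty: "0 \<le> \<delta> \<Longrightarrow> hausdorff_premeasure d \<delta> {} = 0"
  using hausdorff_premeasure_le_cover[of "\<lambda>_. {}" \<delta> "{}" d] by simp

lemma hausdorff_premeasure_mono:
  "E \<subseteq> F \<Longrightarrow> hausdorff_premeasure d \<delta> E \<le> hausdorff_premeasure d \<delta> F"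
  unfolding hausdorff_premeasure_def by (rule INF_superset_mono) auto

lemma hausdorff_premeasure_antimono:
  "\<delta> \<le> \<delta>' \<Longrightarrow> hausdorff_premeasure d \<delta>' E \<le> hausdorff_premeasure d \<delta> E"
  unfolding hausdorff_premeasure_def by (rule INF_superset_mono) (auto intro: order_trans)

lemma hausdorff_premeasure_UN_le:
  "hausdorff_premeasure d \<delta> (\<Union>n::nat. E n) \<le> (\<Sum>n. hausdorff_premeasure d \<delta> (E n))"
proof (rule ennreal_le_epsilon)
  fix e :: real
  assume fin: "(\<Sum>n. hausdorff_premeasure d \<delta> (E n)) < top" and e: "0 < e"
  have "\<exists>C. (\<forall>n::nat. bounded (C n) \<and> diameter (C n) \<le> \<delta>) \<and> E m \<subseteq> (\<Union>n. C n)
      \<and> (\<Sum>n. hausdorff_gauge d (C n)) < hausdorff_premeasure d \<delta> (E m) + e * (1/2) ^ Suc m" for m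
  proof -
    have "hausdorff_premeasure d \<delta> (E m) < hausdorff_premeasure d \<delta> (E m) + e * (1/2) ^ Suc m"
      using fin e by (auto simp add: less_top dest!: ennreal_suminf_lessD)
    then show ?thesis
      unfolding hausdorff_premeasure_def[of d \<delta> "E m"] INF_less_iff by auto
  qed
  then obtain C :: "nat \<Rightarrow> nat \<Rightarrow> 'a set" where
    C: "\<And>m n. bounded (C m n)" "\<And>m n. diameter (C m n) \<le> \<delta>" "\<And>m. E m \<subseteq> (\<Union>n. C m n)"
    and lt: "\<And>m. (\<Sum>n. hausdorff_gauge d (C m n))
               < hausdorff_premeasure d \<delta> (E m) + e * (1/2) ^ Suc m"
    by metis
  define D where "D = case_prod C \<circ> prod_decode"
  have "(\<Union>m. E m) \<subseteq> (\<Union>k. D k)"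
    using C(3) by (auto simp add: D_def subset_eq) (metis prod.case prod_encode_inverse)
  then have "hausdorff_premeasure d \<delta> (\<Union>m. E m) \<le> (\<Sum>k. hausdorff_gauge d (D k))"
    using C(1,2) by (intro hausdorff_premeasure_le_cover) (auto simp: D_def split: prod.splits)
  also have "\<dots> = (\<Sum>m. \<Sum>n. hausdorff_gauge d (C m n))"
    unfolding D_def comp_def by (intro suminf_ennreal_2dimen) auto
  also have "\<dots> \<le> (\<Sum>m. hausdorff_premeasure d \<delta> (E m) + e * (1/2) ^ Suc m)"
    by (intro suminf_le less_imp_le lt) auto
  also have "\<dots> = (\<Sum>m. hausdorff_premeasure d \<delta> (E m)) + (\<Sum>m. ennreal e * ennreal ((1/2) ^ Suc m))"
    using e by (subst suminf_add[symmetric])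
      (auto simp del: ennreal_suminf_cmult simp add: ennreal_mult[symmetric])
  also have "\<dots> = (\<Sum>m. hausdorff_premeasure d \<delta> (E m)) + e"
    unfolding ennreal_suminf_cmult
    by (subst suminf_ennreal_eq[OF zero_le_power power_half_series]) auto
  finally show "hausdorff_premeasure d \<delta> (\<Union>m. E m)
      \<le> (\<Sum>m. hausdorff_premeasure d \<delta> (E m)) + ennreal e" .
qed

lemma hausdorff_premeasure_Un_le:
  assumes "0 \<le> \<delta>"
  shows "hausdorff_premeasure d \<delta> (A \<union> B) \<le> hausdorff_premeasure d \<delta> A + hausdorff_premeasure d \<delta> B"
proof -
  let ?E = "\<lambda>n::nat. if n = 0 then A else if n = 1 then B else {}"
  have "hausdorff_premeasure d \<delta> (A \<union> B) = hausdorff_premeasure d \<delta> (\<Union>n. ?E n)"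
    by (rule arg_cong[where f = "hausdorff_premeasure d \<delta>"]) (auto split: if_splits)
  also have "\<dots> \<le> (\<Sum>n. hausdorff_premeasure d \<delta> (?E n))"
    by (rule hausdorff_premeasure_UN_le)
  also have "\<dots> = (\<Sum>n<2. hausdorff_premeasure d \<delta> (?E n))"
    by (rule suminf_finite) (use assms in \<open>auto simp: hausdorff_premeasure_empty\<close>)
  finally show ?thesis
    by (simp add: numeral_2_eq_2)
qed

lemma hausdorff_premeasure_le_outer: "0 < \<delta> \<Longrightarrow> hausdorff_premeasure d \<delta> E \<le> hausdorff_outer d E"
  unfolding hausdorff_outer_def by (rule SUP_upper) auto

lemma hausdorff_outer_empty [simp]: "hausdorff_outer d {} = 0"
  by (simp add: hausdorff_outer_def hausdorff_premeasure_empty)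

lemma hausdorff_outer_mono: "E \<subseteq> F \<Longrightarrow> hausdorff_outer d E \<le> hausdorff_outer d F"
  unfolding hausdorff_outer_def by (intro SUP_mono) (auto intro: hausdorff_premeasure_mono)

lemma hausdorff_outer_UN_le: "hausdorff_outer d (\<Union>n::nat. E n) \<le> (\<Sum>n. hausdorff_outer d (E n))"
proof -
  have "hausdorff_premeasure d \<delta> (\<Union>n. E n) \<le> (\<Sum>n. hausdorff_outer d (E n))" if "0 < \<delta>" for \<delta>
    by (rule order_trans[OF hausdorff_premeasure_UN_le])
      (intro suminf_le hausdorff_premeasure_le_outer that, auto)
  then show ?thesis
    unfolding hausdorff_outer_def[of d "\<Union>n. E n"] by (intro SUP_least) auto
qed

lemma hausdorff_outer_Un_le: "hausdorff_outer d (A \<union> B) \<le> hausdorff_outer d A + hausdorff_outer d B"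
proof -
  have "hausdorff_premeasure d \<delta> (A \<union> B) \<le> hausdorff_outer d A + hausdorff_outer d B" if "0 < \<delta>" for \<delta>
    using that by (intro order_trans[OF hausdorff_premeasure_Un_le] add_mono hausdorff_premeasure_le_outer) auto
  then show ?thesis
    unfolding hausdorff_outer_def[of d "A \<union> B"] by (intro SUP_least) auto
qed

text \<open>A covering set of diameter below the distance of two sets meets at most one of them, so a
  fine cover of the union splits into a cover of each.\<close>

lemma hausdorff_outer_separated:
  fixes A B :: "'a::metric_space set"
  assumes \<eta>: "0 < \<eta>" and sep: "\<And>x y. x \<in> A \<Longrightarrow> y \<in> B \<Longrightarrow> \<eta> \<le> dist x y"
  shows "hausdorff_outer d A + hausdorff_outer d B \<le> hausdorff_outer d (A \<union> B)"
proof -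
  have fine: "hausdorff_premeasure d \<delta> A + hausdorff_premeasure d \<delta> B \<le> hausdorff_premeasure d \<delta> (A \<union> B)"
    if \<delta>: "0 < \<delta>" "\<delta> < \<eta>" for \<delta>
    unfolding hausdorff_premeasure_def[of d \<delta> "A \<union> B"]
  proof (rule INF_greatest, safe)
    fix C :: "nat \<Rightarrow> 'a set"
    assume C: "\<forall>n. bounded (C n) \<and> diameter (C n) \<le> \<delta>" and cov: "A \<union> B \<subseteq> (\<Union>n. C n)"
    define CA where "CA n = (if C n \<inter> A = {} then {} else C n)" for n
    define CB where "CB n = (if C n \<inter> B = {} then {} else C n)" for n
    have one: "C n \<inter> A = {} \<or> C n \<inter> B = {}" for n
    proof (rule ccontr)
      assume "\<not> ?thesis"
      then obtain x y where "x \<in> C n" "x \<in> A" "y \<in> C n" "y \<in> B"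
        by blast
      then have "dist x y \<le> diameter (C n)" "\<eta> \<le> dist x y"
        using diameter_bounded_bound[of "C n" x y] C sep[of x y] by auto
      then show False
        using C \<delta> by (meson leD le_less_trans order_trans)
    qed
    have "hausdorff_premeasure d \<delta> A \<le> (\<Sum>n. hausdorff_gauge d (CA n))"
      using C cov \<delta> by (intro hausdorff_premeasure_le_cover) (auto simp: CA_def subset_eq, blast)
    moreover have "hausdorff_premeasure d \<delta> B \<le> (\<Sum>n. hausdorff_gauge d (CB n))"
      using C cov \<delta> by (intro hausdorff_premeasure_le_cover) (auto simp: CB_def subset_eq, blast)
    ultimately have "hausdorff_premeasure d \<delta> A + hausdorff_premeasure d \<delta> B
        \<le> (\<Sum>n. hausdorff_gauge d (CA n)) + (\<Sum>n. hausdorff_gauge d (CB n))"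
      by (rule add_mono)
    also have "\<dots> = (\<Sum>n. hausdorff_gauge d (CA n) + hausdorff_gauge d (CB n))"
      by (rule suminf_add) auto
    also have "\<dots> \<le> (\<Sum>n. hausdorff_gauge d (C n))"
      using one by (intro suminf_le) (auto simp: CA_def CB_def)
    finally show "hausdorff_premeasure d \<delta> A + hausdorff_premeasure d \<delta> B
        \<le> (\<Sum>n. hausdorff_gauge d (C n))" .
  qed
  have "hausdorff_outer d A + hausdorff_outer d B
      = (SUP \<delta>\<in>{0<..}. hausdorff_premeasure d \<delta> A + hausdorff_premeasure d \<delta> B)"
    unfolding hausdorff_outer_def
  proof (rule SUP_add_directed_ennreal[symmetric])
    fix i j :: real
    assume "i \<in> {0<..}" "j \<in> {0<..}"
    then show "\<exists>k\<in>{0<..}. hausdorff_premeasure d i A + hausdorff_premeasure d j B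
        \<le> hausdorff_premeasure d k A + hausdorff_premeasure d k B"
      by (intro bexI[of _ "min i j"] add_mono hausdorff_premeasure_antimono) auto
  qed
  also have "\<dots> \<le> hausdorff_outer d (A \<union> B)"
  proof (rule SUP_least)
    fix \<delta> :: real
    assume "\<delta> \<in> {0<..}"
    then have m: "0 < min \<delta> (\<eta> / 2)" "min \<delta> (\<eta> / 2) < \<eta>"
      using \<eta> by auto
    have "hausdorff_premeasure d \<delta> A + hausdorff_premeasure d \<delta> B
        \<le> hausdorff_premeasure d (min \<delta> (\<eta> / 2)) A + hausdorff_premeasure d (min \<delta> (\<eta> / 2)) B"
      by (intro add_mono hausdorff_premeasure_antimono) auto
    also have "\<dots> \<le> hausdorff_outer d (A \<union> B)"
      using fine[OF m] hausdorff_premeasure_le_outer[OF m(1)] by (rule order_trans)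
    finally show "hausdorff_premeasure d \<delta> A + hausdorff_premeasure d \<delta> B \<le> hausdorff_outer d (A \<union> B)" .
  qed
  finally show ?thesis .
qed

text \<open>Caratheodory's criterion for a closed set C: the part of X outside C is exhausted by the sets
  of points at distance at least 1/(n+1) from C, which are separated from C. What remains splits
  into shells R k, and shells of equal parity are separated from each other. Hence the measures of
  the shells form a convergent series, whose tails vanish.\<close>

lemma hausdorff_outer_closed_split:
  fixes C X :: "'a::metric_space set"
  assumes "closed C"
  shows "hausdorff_outer d (X \<inter> C) + hausdorff_outer d (X - C) \<le> hausdorff_outer d X"
proof (cases "C = {} \<or> hausdorff_outer d X = \<infinity>")
  case True
  then show ?thesis
    by auto
next
  case False
  let ?H = "hausdorff_outer d"
  define f where "f x = infdist x C" for x
  have f_lip: "f x - f y \<le> dist x y" for x y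
    using infdist_triangle[of x C y] by (simp add: f_def)
  have f_pos: "0 < f x" if "x \<notin> C" for x
    using that False assms in_closed_iff_infdist_zero[of C x] infdist_nonneg[of x C]
    by (auto simp: f_def less_le)
  define R where "R k = {x \<in> X. 1 / real (k + 2) \<le> f x \<and> f x < 1 / real (k + 1)}" for k :: nat
  define Y where "Y n = {x \<in> X. 1 / real (n + 1) \<le> f x}" for n :: nat
  have alternate: "(\<Sum>k<n. ?H (R (2 * k + p))) \<le> ?H (\<Union>k<n. R (2 * k + p))" for n p
  proof (induction n)
    case (Suc n)
    have "(\<Sum>k<Suc n. ?H (R (2 * k + p))) \<le> ?H (\<Union>k<n. R (2 * k + p)) + ?H (R (2 * n + p))"
      using Suc by (simp add: add_mono)
    also have "\<dots> \<le> ?H ((\<Union>k<n. R (2 * k + p)) \<union> R (2 * n + p))"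
    proof (cases "n = 0")
      case False
      show ?thesis
      proof (rule hausdorff_outer_separated)
        show "0 < 1 / real (2 * n + p) - 1 / real (2 * n + p + 1)"
          using False by (simp add: frac_less2)
      next
        fix x y
        assume "x \<in> (\<Union>k<n. R (2 * k + p))" and y: "y \<in> R (2 * n + p)"
        then obtain k where k: "k < n" "1 / real (2 * k + p + 2) \<le> f x"
          by (auto simp: R_def)
        have "1 / real (2 * n + p) \<le> 1 / real (2 * k + p + 2)"
          using k by (intro divide_left_mono) auto
        then show "1 / real (2 * n + p) - 1 / real (2 * n + p + 1) \<le> dist x y"
          using k y f_lip[of x y] by (auto simp: R_def)
      qed
    qed auto
    also have "(\<Union>k<n. R (2 * k + p)) \<union> R (2 * n + p) = (\<Union>k<Suc n. R (2 * k + p))"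
      by (auto simp: lessThan_Suc)
    finally show ?case .
  qed simp
  have half: "(\<Sum>k<n. ?H (R (2 * k + p))) \<le> ?H X" for n p
    by (rule order_trans[OF alternate hausdorff_outer_mono]) (auto simp: R_def)
  have partial: "(\<Sum>k<n. ?H (R k)) \<le> 2 * ?H X" for n
  proof -
    have "(\<Sum>k<n. ?H (R k)) \<le> (\<Sum>k<2*n. ?H (R k))"
      by (rule sum_mono2) auto
    also have "\<dots> = (\<Sum>k<n. ?H (R (2 * k + 0))) + (\<Sum>k<n. ?H (R (2 * k + 1)))"
      by (induction n) (simp_all add: algebra_simps)
    also have "\<dots> \<le> ?H X + ?H X"
      by (intro add_mono half)
    finally show ?thesis
      by (simp add: mult_2)
  qed
  define S where "S = (\<Sum>k. ?H (R k))"
  have S_fin: "S < \<infinity>"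
  proof -
    have "S \<le> 2 * ?H X"
      unfolding S_def by (rule suminf_le_const) (auto intro: partial)
    also have "\<dots> < \<infinity>"
      using False by (simp add: ennreal_mult_less_top less_top)
    finally show ?thesis .
  qed
  show ?thesis
  proof (rule ennreal_le_epsilon)
    fix e :: real
    assume "0 < e"
    have "\<exists>n. S \<le> ennreal e + (\<Sum>k<n. ?H (R k))"
    proof (cases "S = 0")
      case False
      then have "S - ennreal e < S"
        using S_fin \<open>0 < e\<close> by (cases S) (auto simp: ennreal_minus intro!: ennreal_lessI)
      then have "S - ennreal e < (SUP n. \<Sum>k<n. ?H (R k))"
        by (simp add: S_def suminf_eq_SUP)
      then obtain n where "S - ennreal e \<le> (\<Sum>k<n. ?H (R k))"
        unfolding less_SUP_iff by (blast intro: less_imp_le)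
      then show ?thesis
        unfolding ennreal_minus_le_iff by blast
    qed simp
    then obtain n where n: "S \<le> ennreal e + (\<Sum>k<n. ?H (R k))" ..
    define P where "P = (\<Sum>k<n. ?H (R k))"
    define T where "T = (\<Sum>k. ?H (R (k + n)))"
    have P: "P \<le> S"
      unfolding P_def S_def by (rule sum_le_suminf) auto
    then have P_fin: "P \<noteq> \<infinity>"
      using S_fin by auto
    have "P + T \<le> S"
    proof -
      have "T = (SUP m. \<Sum>k<m. ?H (R (k + n)))"
        by (simp add: T_def suminf_eq_SUP)
      then have "P + T = (SUP m. P + (\<Sum>k<m. ?H (R (k + n))))"
        by (simp add: ennreal_SUP_add_right)
      also have "\<dots> \<le> S"
      proof (rule SUP_least)
        fix m
        have "P + (\<Sum>k<m. ?H (R (k + n))) = (\<Sum>k<m + n. ?H (R k))"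
          by (induction m) (simp_all add: P_def add.assoc[symmetric])
        also have "\<dots> \<le> S"
          unfolding S_def by (rule sum_le_suminf) auto
        finally show "P + (\<Sum>k<m. ?H (R (k + n))) \<le> S" .
      qed
      finally show ?thesis .
    qed
    also have "S \<le> P + ennreal e"
      using n by (simp only: P_def add.commute)
    finally have "P + T \<le> P + ennreal e" .
    then have "T \<le> ennreal e"
      using P_fin by (simp add: ennreal_add_left_cancel_le)
    have rest: "X - C \<subseteq> Y n \<union> (\<Union>k. R (k + n))"
    proof
      fix x
      assume x: "x \<in> X - C"
      then have pos: "0 < f x"
        using f_pos by auto
      show "x \<in> Y n \<union> (\<Union>k. R (k + n))"
      proof (cases "1 / real (n + 1) \<le> f x")
        case False
        define m where "m = (LEAST m. 1 / real (m + 2) \<le> f x)"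
        have "\<exists>m::nat. 1 / real (m + 2) \<le> f x"
        proof -
          obtain m where "inverse (real (Suc m)) < f x"
            using reals_Archimedean[OF pos] by auto
          with pos show ?thesis
            by (intro exI[of _ m]) (simp add: field_simps)
        qed
        then have m1: "1 / real (m + 2) \<le> f x"
          unfolding m_def by (rule LeastI_ex)
        then have "1 / real (m + 2) < 1 / real (n + 1)"
          using False by linarith
        then have mn: "n \<le> m"
          by (auto simp: field_simps)
        have "f x < 1 / real (m + 1)"
        proof (cases "m = 0")
          case False
          then have "\<not> 1 / real (m - 1 + 2) \<le> f x"
            using not_less_Least[of "m - 1" "\<lambda>m. 1 / real (m + 2) \<le> f x"] by (auto simp: m_def)
          with False show ?thesis
            by (auto simp: of_nat_diff algebra_simps)
        qed (use False mn in auto)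
        with m1 x have "x \<in> R ((m - n) + n)"
          using mn by (auto simp: R_def)
        then show ?thesis
          by blast
      qed (use x in \<open>auto simp: Y_def\<close>)
    qed
    have far: "?H (X - C) \<le> ?H (Y n) + T"
      unfolding T_def
      by (rule order_trans[OF hausdorff_outer_mono[OF rest]], rule order_trans[OF hausdorff_outer_Un_le])
        (intro add_left_mono hausdorff_outer_UN_le)
    have near: "?H (X \<inter> C) + ?H (Y n) \<le> ?H X"
    proof -
      have "?H (Y n) + ?H (X \<inter> C) \<le> ?H (Y n \<union> (X \<inter> C))"
        by (rule hausdorff_outer_separated[of "1 / real (n + 1)"])
          (auto simp: Y_def f_def intro: order_trans[OF _ infdist_le])
      also have "\<dots> \<le> ?H X"
        by (rule hausdorff_outer_mono) (auto simp: Y_def)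
      finally show ?thesis
        by (simp add: add.commute)
    qed
    have "?H (X \<inter> C) + ?H (X - C) \<le> ?H (X \<inter> C) + (?H (Y n) + T)"
      using far by (rule add_left_mono)
    also have "\<dots> \<le> ?H X + T"
      unfolding add.assoc[symmetric] using near by (rule add_right_mono)
    also have "\<dots> \<le> ?H X + ennreal e"
      using \<open>T \<le> ennreal e\<close> by (rule add_left_mono)
    finally show "?H (X \<inter> C) + ?H (X - C) \<le> ?H X + ennreal e" .
  qed
qed

text \<open>The measurable sets in the sense of Caratheodory contain the closed sets, hence the Borel sets,
  on which the outer measure is therefore countably additive.\<close>

lemma emeasure_hausdorff_measure:
  assumes "E \<in> sets borel"
  shows "emeasure (hausdorff_measure d) (E :: 'a::metric_space set) = hausdorff_outer d E"
proof -
  let ?L = "lambda_system UNIV UNIV (hausdorff_outer d :: 'a set \<Rightarrow> ennreal)"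
  have "outer_measure_space (UNIV :: 'a set set) (hausdorff_outer d)"
    by (auto simp: outer_measure_space_def positive_def increasing_def countably_subadditive_def
        intro: hausdorff_outer_mono hausdorff_outer_UN_le)
  then have L: "measure_space UNIV ?L (hausdorff_outer d)"
    using sigma_algebra.caratheodory_lemma[OF sigma_algebra_Pow[of "UNIV :: 'a set"]]
    by simp
  have "{S :: 'a set. closed S} \<subseteq> ?L"
  proof safe
    fix C :: "'a set"
    assume "closed C"
    have "hausdorff_outer d (C \<inter> X) + hausdorff_outer d ((UNIV - C) \<inter> X) = hausdorff_outer d X" for X
    proof (rule antisym)
      have eq: "C \<inter> X = X \<inter> C" "(UNIV - C) \<inter> X = X - C"
        by auto
      show "hausdorff_outer d (C \<inter> X) + hausdorff_outer d ((UNIV - C) \<inter> X) \<le> hausdorff_outer d X"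
        unfolding eq using \<open>closed C\<close> by (rule hausdorff_outer_closed_split)
      show "hausdorff_outer d X \<le> hausdorff_outer d (C \<inter> X) + hausdorff_outer d ((UNIV - C) \<inter> X)"
        by (rule order_trans[OF hausdorff_outer_mono hausdorff_outer_Un_le]) auto
    qed
    then show "C \<in> ?L"
      by (simp add: lambda_system_def)
  qed
  then have sub: "sets (borel :: 'a measure) \<subseteq> ?L"
    using L sigma_algebra.sigma_sets_subset[of UNIV ?L "{S. closed S}"]
    by (simp add: borel_eq_closed measure_space_def)
  have "measure_space UNIV (sets (borel :: 'a measure)) (hausdorff_outer d)"
    by (rule measure_down[OF L _ sub])
      (use sets.sigma_algebra_axioms[of "borel :: 'a measure"] in simp_all)
  then have "positive (sets (borel :: 'a measure)) (hausdorff_outer d)"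
    "countably_additive (sets (borel :: 'a measure)) (hausdorff_outer d)"
    by (auto simp: measure_space_def)
  then show ?thesis
    unfolding hausdorff_measure_def using assms
    by (intro emeasure_measure_of_sigma)
      (use sets.sigma_algebra_axioms[of "borel :: 'a measure"] in simp_all)
qed

lemma sets_hausdorff_measure [simp, measurable_cong]:
  "sets (hausdorff_measure d :: 'a::metric_space measure) = sets borel"
  unfolding hausdorff_measure_def
  by (metis sets.sigma_sets_eq sets_measure_of space_borel sets.space_closed)

lemma space_hausdorff_measure [simp]: "space (hausdorff_measure d) = UNIV"
  by (simp add: hausdorff_measure_def space_measure_of_conv)

section \<open>Powers of extended nonnegative reals and the inequality of Finner\<close>

text \<open>Meant for positive exponents: 0 and \<open>top\<close> are fixed points, and products are respected,
  including \<open>0 * top = 0\<close>. With exponent 0 the values at 0 and \<open>top\<close> are not 1.\<close>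

definition epowr :: "ennreal \<Rightarrow> real \<Rightarrow> ennreal" where
  "epowr x p = (if x = top then top else ennreal (enn2real x powr p))"

lemma epowr_top [simp]: "epowr top p = top"
  by (simp add: epowr_def)

lemma epowr_zero [simp]: "epowr 0 p = 0"
  by (simp add: epowr_def)

lemma epowr_ennreal: "0 \<le> x \<Longrightarrow> epowr (ennreal x) p = ennreal (x powr p)"
  by (simp add: epowr_def)

lemma epowr_eq_0_iff [simp]: "epowr x p = 0 \<longleftrightarrow> x = 0"
  by (cases x) (auto simp: epowr_ennreal ennreal_eq_0_iff)

lemma epowr_mono: "x \<le> y \<Longrightarrow> 0 \<le> p \<Longrightarrow> epowr x p \<le> epowr y p"
  by (cases x; cases y) (auto simp: epowr_ennreal top_unique intro!: ennreal_leI powr_mono2)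

lemma epowr_mult: "epowr (x * y) p = epowr x p * epowr y p"
proof (cases "x = top \<or> y = top")
  case True
  then show ?thesis
    by (auto simp: ennreal_top_mult ennreal_mult_top)
next
  case False
  then show ?thesis
    by (cases x; cases y) (auto simp: epowr_ennreal ennreal_mult[symmetric] powr_mult)
qed

lemma epowr_add: "epowr x (p + q) = epowr x p * epowr x q"
  by (cases x) (auto simp: epowr_ennreal ennreal_mult[symmetric] powr_add ennreal_top_mult)

lemma epowr_epowr: "epowr (epowr x p) q = epowr x (p * q)"
  by (cases x) (auto simp: epowr_ennreal powr_powr)

lemma epowr_1 [simp]: "epowr x 1 = x"
  by (cases x) (auto simp: epowr_ennreal)

lemma prod_epowr:
  assumes "finite J" "J \<noteq> {}"
  shows "(\<Prod>j\<in>J. epowr x (p j)) = epowr x (\<Sum>j\<in>J. p j)"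
  using assms by (induction J rule: finite_ne_induct) (auto simp: epowr_add)

lemma borel_measurable_epowr [measurable]:
  assumes [measurable]: "f \<in> borel_measurable M"
  shows "(\<lambda>x. epowr (f x) p) \<in> borel_measurable M"
  unfolding epowr_def by measurable

lemma prod_ennreal_eq_top:
  fixes f :: "'a \<Rightarrow> ennreal"
  assumes "finite J" "j \<in> J" "f j = top" "\<And>j. j \<in> J \<Longrightarrow> f j \<noteq> 0"
  shows "(\<Prod>j\<in>J. f j) = top"
proof -
  have "(\<Prod>j\<in>J. f j) = f j * (\<Prod>j\<in>J - {j}. f j)"
    using assms by (simp add: prod.remove)
  moreover have "(\<Prod>j\<in>J - {j}. f j) \<noteq> 0"
    using assms by (simp add: prod_zero_iff)
  ultimately show ?thesis
    using assms(3) by (simp add: ennreal_top_mult)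
qed

lemma weighted_AM_GM_real:
  fixes x p :: "'a \<Rightarrow> real"
  assumes "finite J" "J \<noteq> {}" "\<And>j. j \<in> J \<Longrightarrow> 0 < p j" "(\<Sum>j\<in>J. p j) = 1"
    "\<And>j. j \<in> J \<Longrightarrow> 0 < x j"
  shows "(\<Prod>j\<in>J. x j powr p j) \<le> (\<Sum>j\<in>J. p j * x j)"
proof -
  have "(\<Prod>j\<in>J. x j powr p j) = exp (\<Sum>j\<in>J. p j *\<^sub>R ln (x j))"
    unfolding exp_sum[OF assms(1)] using assms(5)
    by (intro prod.cong refl) (force simp: powr_def)
  also have "\<dots> \<le> (\<Sum>j\<in>J. p j * exp (ln (x j)))"
    by (rule convex_on_sum[OF _ _ exp_convex]) (use assms in \<open>auto intro: less_imp_le\<close>)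
  also have "\<dots> = (\<Sum>j\<in>J. p j * x j)"
    using assms by (intro sum.cong) auto
  finally show ?thesis .
qed

text \<open>A factor 0 makes the left-hand side 0, an infinite term makes the right-hand side infinite; all
  other cases are about positive reals.\<close>

lemma weighted_AM_GM:
  assumes J: "finite J" "J \<noteq> {}" and p: "\<And>j. j \<in> J \<Longrightarrow> 0 < p j" "(\<Sum>j\<in>J. p j) = 1"
  shows "(\<Prod>j\<in>J. epowr (x j) (p j)) \<le> (\<Sum>j\<in>J. ennreal (p j) * x j)"
proof (cases "(\<exists>j\<in>J. x j = 0) \<or> (\<exists>j\<in>J. x j = top)")
  case True
  then consider j where "j \<in> J" "x j = 0" | j where "j \<in> J" "x j = top"
    by blast
  then show ?thesis
  proof cases
    case 1
    then have "(\<Prod>j\<in>J. epowr (x j) (p j)) = 0"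
      using J by (intro prod_zero) auto
    then show ?thesis
      by (simp only: zero_le)
  next
    case 2
    then have "ennreal (p j) * x j = top"
      using p(1)[of j] by (simp add: ennreal_mult_top ennreal_eq_0_iff)
    then have "(\<Sum>j\<in>J. ennreal (p j) * x j) = top"
      using J(1) 2(1) member_le_sum[of j J "\<lambda>j. ennreal (p j) * x j"] by (simp add: top_unique)
    then show ?thesis
      by simp
  qed
next
  case False
  define y where "y j = enn2real (x j)" for j
  have x: "x j = ennreal (y j)" and y: "0 < y j" if "j \<in> J" for j
    using that False by (auto simp: y_def less_top enn2real_positive_iff zero_less_iff_neq_zero)
  have "(\<Prod>j\<in>J. epowr (x j) (p j)) = ennreal (\<Prod>j\<in>J. y j powr p j)"
    using x y by (subst prod_ennreal[symmetric]) (auto simp: epowr_ennreal less_imp_le)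
  also have "\<dots> \<le> ennreal (\<Sum>j\<in>J. p j * y j)"
    using J p y by (intro ennreal_leI weighted_AM_GM_real)
  also have "\<dots> = (\<Sum>j\<in>J. ennreal (p j) * x j)"
    using x y p by (subst sum_ennreal[symmetric]) (auto simp: ennreal_mult less_imp_le)
  finally show ?thesis .
qed

text \<open>Hoelder's inequality for several functions: normalize all integrals to 1 and integrate the
  weighted inequality of arithmetic and geometric means.\<close>

lemma nn_integral_Holder:
  assumes J: "finite J" "J \<noteq> {}" and p: "\<And>j. j \<in> J \<Longrightarrow> 0 < p j" "(\<Sum>j\<in>J. p j) = 1"
    and f [measurable]: "\<And>j. j \<in> J \<Longrightarrow> f j \<in> borel_measurable M"
  shows "(\<integral>\<^sup>+x. (\<Prod>j\<in>J. epowr (f j x) (p j)) \<partial>M) \<le> (\<Prod>j\<in>J. epowr (\<integral>\<^sup>+x. f j x \<partial>M) (p j))"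
proof -
  define c where "c j = (\<integral>\<^sup>+x. f j x \<partial>M)" for j
  consider (zero) j where "j \<in> J" "c j = 0"
    | (inf) j where "j \<in> J" "c j = top" "\<And>j. j \<in> J \<Longrightarrow> c j \<noteq> 0"
    | (normal) "\<And>j. j \<in> J \<Longrightarrow> c j \<noteq> 0" "\<And>j. j \<in> J \<Longrightarrow> c j \<noteq> top"
    by blast
  then show ?thesis
  proof cases
    case zero
    then have "AE x in M. f j x = 0"
      using nn_integral_0_iff_AE[OF f[OF zero(1)]] by (simp add: c_def)
    then have "AE x in M. (\<Prod>j\<in>J. epowr (f j x) (p j)) = 0"
    proof eventually_elim
      case (elim x)
      with J(1) zero(1) show ?case
        by (intro prod_zero) (auto intro!: bexI[of _ j])
    qed
    then have "(\<integral>\<^sup>+x. (\<Prod>j\<in>J. epowr (f j x) (p j)) \<partial>M) = (\<integral>\<^sup>+x. 0 \<partial>M)"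
      by (rule nn_integral_cong_AE)
    then show ?thesis
      by simp
  next
    case inf
    then have "(\<Prod>j\<in>J. epowr (c j) (p j)) = top"
      using J by (intro prod_ennreal_eq_top[of J j]) auto
    then show ?thesis
      by (simp add: c_def)
  next
    case normal
    have "(\<integral>\<^sup>+x. (\<Prod>j\<in>J. epowr (f j x) (p j)) \<partial>M)
        \<le> (\<integral>\<^sup>+x. (\<Prod>j\<in>J. epowr (c j) (p j)) * (\<Sum>j\<in>J. ennreal (p j) * (f j x / c j)) \<partial>M)"
    proof (rule nn_integral_mono)
      fix x
      have "(\<Prod>j\<in>J. epowr (f j x) (p j)) = (\<Prod>j\<in>J. epowr (c j) (p j) * epowr (f j x / c j) (p j))"
        using normal by (intro prod.cong refl) (simp add: epowr_mult[symmetric] ennreal_times_divide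
            ennreal_mult_divide_eq mult.commute[of "c _"])
      also have "\<dots> = (\<Prod>j\<in>J. epowr (c j) (p j)) * (\<Prod>j\<in>J. epowr (f j x / c j) (p j))"
        by (rule prod.distrib)
      also have "\<dots> \<le> (\<Prod>j\<in>J. epowr (c j) (p j)) * (\<Sum>j\<in>J. ennreal (p j) * (f j x / c j))"
        by (intro mult_left_mono weighted_AM_GM J p) auto
      finally show "(\<Prod>j\<in>J. epowr (f j x) (p j))
          \<le> (\<Prod>j\<in>J. epowr (c j) (p j)) * (\<Sum>j\<in>J. ennreal (p j) * (f j x / c j))" .
    qed
    also have "\<dots> = (\<Prod>j\<in>J. epowr (c j) (p j)) * (\<Sum>j\<in>J. ennreal (p j) * (c j / c j))"
      by (simp add: nn_integral_cmult nn_integral_sum nn_integral_divide c_def)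
    also have "(\<Sum>j\<in>J. ennreal (p j) * (c j / c j)) = (\<Sum>j\<in>J. ennreal (p j))"
      using normal by (intro sum.cong) (auto simp: ennreal_divide_self less_top)
    also have "\<dots> = 1"
      using p by (subst sum_ennreal) (auto intro: less_imp_le)
    finally show ?thesis
      by (simp add: c_def)
  qed
qed

text \<open>Integrating out one coordinate at a time, Hoelder's inequality applies to the functions that
  depend on it, whose exponents sum to 1, while the other functions are constants. The
  Loomis--Whitney inequality is the case where each of the n functions omits one coordinate and
  all exponents are 1/(n-1).\<close>

lemma (in product_sigma_finite) Finner_inequality:
  assumes "finite I" and J: "finite J" and p: "\<And>j. j \<in> J \<Longrightarrow> 0 < p j"
    and "\<And>j. j \<in> J \<Longrightarrow> K j \<subseteq> I"
    and "\<And>j. j \<in> J \<Longrightarrow> f j \<in> borel_measurable (PiM (K j) M)"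
    and "\<And>i. i \<in> I \<Longrightarrow> (\<Sum>j | j \<in> J \<and> i \<in> K j. p j) = 1"
  shows "(\<integral>\<^sup>+x. (\<Prod>j\<in>J. epowr (f j (restrict x (K j))) (p j)) \<partial>PiM I M)
      \<le> (\<Prod>j\<in>J. epowr (\<integral>\<^sup>+x. f j x \<partial>PiM (K j) M) (p j))"
  using assms(1,4-6)
proof (induction I arbitrary: K f rule: finite_induct)
  case empty
  then have "K j = {}" if "j \<in> J" for j
    using that by blast
  then show ?case
    by (simp add: nn_integral_empty restrict_def space_PiM_empty cong: prod.cong)
next
  case (insert i I)
  note K = insert.prems(1) and f = insert.prems(2)
  define K' where "K' j = K j - {i}" for j
  define f' where "f' j = (if i \<in> K j then (\<lambda>x. \<integral>\<^sup>+y. f j (x(i := y)) \<partial>M i) else f j)" for j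
  define J0 where "J0 = {j \<in> J. i \<notin> K j}"
  define J1 where "J1 = {j \<in> J. i \<in> K j}"
  have fin: "finite J0" "finite J1" "J0 \<inter> J1 = {}" "J = J0 \<union> J1"
    using J by (auto simp: J0_def J1_def)
  have p1: "(\<Sum>j\<in>J1. p j) = 1"
    using insert.prems(3)[of i] by (simp add: J1_def)
  then have "J1 \<noteq> {}"
    by auto
  have ins: "insert i (K' j) = K j" if "j \<in> J1" for j
    using that by (auto simp: K'_def J1_def)
  have f1: "f j \<in> borel_measurable (PiM (insert i (K' j)) M)" if "j \<in> J1" for j
    using f[of j] that by (simp add: ins) (simp add: J1_def)
  have upd: "(\<lambda>y. f j (z(i := y))) \<in> borel_measurable (M i)"
    if "j \<in> J1" "z \<in> space (PiM (K' j) M)" for j z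
    using measurable_compose[OF measurable_component_update[OF that(2)] f1[OF that(1)]]
    by (simp add: K'_def)
  have f'_meas: "f' j \<in> borel_measurable (PiM (K' j) M)" if "j \<in> J" for j
  proof (cases "i \<in> K j")
    case True
    then have "j \<in> J1"
      using that by (simp add: J1_def)
    have "(\<lambda>(x, y). f j (x(i := y))) \<in> borel_measurable (PiM (K' j) M \<Otimes>\<^sub>M M i)"
      using measurable_compose[OF measurable_add_dim f1[OF \<open>j \<in> J1\<close>]] by (simp add: split_def)
    then have "(\<lambda>x. \<integral>\<^sup>+y. f j (x(i := y)) \<partial>M i) \<in> borel_measurable (PiM (K' j) M)"
      by (rule sigma_finite_measure.borel_measurable_nn_integral[OF sigma_finite_measures])
    then show ?thesis
      using True by (simp add: f'_def)
  next
    case False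
    then show ?thesis
      using f[OF that] by (simp add: f'_def K'_def)
  qed
  have meas: "(\<lambda>x. \<Prod>j\<in>J. epowr (f j (restrict x (K j))) (p j)) \<in> borel_measurable (PiM (insert i I) M)"
    by (intro borel_measurable_prod_ennreal borel_measurable_epowr
        measurable_compose[OF measurable_restrict_subset f] K)
  have "(\<integral>\<^sup>+x. (\<Prod>j\<in>J. epowr (f j (restrict x (K j))) (p j)) \<partial>PiM (insert i I) M)
      = (\<integral>\<^sup>+x. \<integral>\<^sup>+y. (\<Prod>j\<in>J. epowr (f j (restrict (x(i := y)) (K j))) (p j)) \<partial>M i \<partial>PiM I M)"
    by (rule product_nn_integral_insert[OF insert.hyps meas])
  also have "\<dots> \<le> (\<integral>\<^sup>+x. (\<Prod>j\<in>J. epowr (f' j (restrict x (K' j))) (p j)) \<partial>PiM I M)"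
  proof (rule nn_integral_mono)
    fix x
    assume x: "x \<in> space (PiM I M)"
    have sub: "K' j \<subseteq> I" if "j \<in> J1" for j
      using K that by (auto simp: K'_def J1_def)
    have z: "restrict x (K' j) \<in> space (PiM (K' j) M)" if "j \<in> J1" for j
      using x sub[OF that] by (auto simp: space_PiM PiE_iff)
    have r0: "restrict (x(i := y)) (K j) = restrict x (K' j)" if "j \<in> J0" for j y
      using that by (auto simp: J0_def K'_def restrict_def fun_eq_iff)
    have r1: "restrict (x(i := y)) (K j) = (restrict x (K' j))(i := y)" if "j \<in> J1" for j y
      using that by (auto simp: J1_def K'_def restrict_def fun_eq_iff)
    have "(\<integral>\<^sup>+y. (\<Prod>j\<in>J. epowr (f j (restrict (x(i := y)) (K j))) (p j)) \<partial>M i)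
        = (\<integral>\<^sup>+y. (\<Prod>j\<in>J0. epowr (f j (restrict x (K' j))) (p j))
            * (\<Prod>j\<in>J1. epowr (f j ((restrict x (K' j))(i := y))) (p j)) \<partial>M i)"
      unfolding fin(4) by (subst prod.union_disjoint) (use fin(1-3) r0 r1 in auto)
    also have "\<dots> = (\<Prod>j\<in>J0. epowr (f j (restrict x (K' j))) (p j))
        * (\<integral>\<^sup>+y. (\<Prod>j\<in>J1. epowr (f j ((restrict x (K' j))(i := y))) (p j)) \<partial>M i)"
      by (intro nn_integral_cmult borel_measurable_prod_ennreal borel_measurable_epowr upd z)
    also have "\<dots> \<le> (\<Prod>j\<in>J0. epowr (f j (restrict x (K' j))) (p j))
        * (\<Prod>j\<in>J1. epowr (\<integral>\<^sup>+y. f j ((restrict x (K' j))(i := y)) \<partial>M i) (p j))"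
      by (intro mult_left_mono nn_integral_Holder upd z p p1 fin \<open>J1 \<noteq> {}\<close>) (auto simp: J1_def)
    also have "\<dots> = (\<Prod>j\<in>J. epowr (f' j (restrict x (K' j))) (p j))"
      unfolding fin(4) by (subst prod.union_disjoint) (use fin(1-3) in \<open>auto simp: f'_def J0_def J1_def\<close>)
    finally show "(\<integral>\<^sup>+y. (\<Prod>j\<in>J. epowr (f j (restrict (x(i := y)) (K j))) (p j)) \<partial>M i)
        \<le> (\<Prod>j\<in>J. epowr (f' j (restrict x (K' j))) (p j))" .
  qed
  also have "\<dots> \<le> (\<Prod>j\<in>J. epowr (\<integral>\<^sup>+x. f' j x \<partial>PiM (K' j) M) (p j))"
  proof (rule insert.IH)
    show "K' j \<subseteq> I" if "j \<in> J" for j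
      using K[OF that] by (auto simp: K'_def)
    show "(\<Sum>j | j \<in> J \<and> i' \<in> K' j. p j) = 1" if "i' \<in> I" for i'
    proof -
      have "{j. j \<in> J \<and> i' \<in> K' j} = {j. j \<in> J \<and> i' \<in> K j}"
        using that insert.hyps by (auto simp: K'_def)
      then show ?thesis
        using insert.prems(3)[of i'] that by simp
    qed
  qed (rule f'_meas)
  also have "\<dots> = (\<Prod>j\<in>J. epowr (\<integral>\<^sup>+x. f j x \<partial>PiM (K j) M) (p j))"
  proof (intro prod.cong refl)
    fix j
    assume "j \<in> J"
    show "epowr (\<integral>\<^sup>+x. f' j x \<partial>PiM (K' j) M) (p j) = epowr (\<integral>\<^sup>+x. f j x \<partial>PiM (K j) M) (p j)"
    proof (cases "i \<in> K j")
      case True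
      then have "j \<in> J1"
        using \<open>j \<in> J\<close> by (simp add: J1_def)
      have "finite (K' j)"
        using K[OF \<open>j \<in> J\<close>] insert.hyps(1) by (auto simp: K'_def intro: finite_subset)
      then have "integral\<^sup>N (PiM (insert i (K' j)) M) (f j) = (\<integral>\<^sup>+x. f' j x \<partial>PiM (K' j) M)"
        using True by (subst product_nn_integral_insert[OF _ _ f1[OF \<open>j \<in> J1\<close>]])
          (auto simp: K'_def f'_def)
      then show ?thesis
        by (simp add: ins[OF \<open>j \<in> J1\<close>])
    qed (simp add: f'_def K'_def)
  qed
  finally show ?case .
qed

section \<open>Lebesgue measure as a product over coordinates\<close>

interpretation lborel_PiM: product_sigma_finite "\<lambda>_. lborel :: real measure"
  by standard

lemma measurable_vec_lambda_PiM [measurable]: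
  "(\<lambda>f. \<chi> i. f i) \<in> PiM UNIV (\<lambda>_::'n::finite. lborel :: real measure) \<rightarrow>\<^sub>M borel"
proof (subst borel_measurable_euclidean_space, safe)
  fix b :: "real ^ 'n"
  assume "b \<in> Basis"
  then obtain i where b: "b = axis i 1"
    by (auto simp: Basis_vec_def)
  show "(\<lambda>f. (\<chi> i. f i) \<bullet> b) \<in> borel_measurable (PiM UNIV (\<lambda>_::'n. lborel :: real measure))"
    by (simp add: b inner_axis)
qed

lemma prod_Basis_vec: "(\<Prod>b\<in>(Basis :: (real ^ 'n) set). g b) = (\<Prod>i\<in>UNIV. g (axis i 1))"
proof -
  have inj: "inj (\<lambda>i::'n. axis i (1::real))"
    by (auto simp: inj_on_def axis_eq_axis)
  have basis: "(Basis :: (real ^ 'n) set) = range (\<lambda>i. axis i 1)"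
    by (auto simp: Basis_vec_def)
  show ?thesis
    by (simp add: basis prod.reindex[OF inj])
qed

text \<open>Indexing the coordinates by the type of indices instead of the basis vectors lets a single
  coordinate be split off as an element of the index type.\<close>

lemma lborel_vec_eq_distr_PiM:
  "(lborel :: (real ^ 'n) measure) = distr (PiM UNIV (\<lambda>_. lborel)) borel (\<lambda>f. \<chi> i. f i)"
proof (rule lborel_eqI)
  fix l u :: "real ^ 'n"
  assume le: "\<And>b. b \<in> Basis \<Longrightarrow> l \<bullet> b \<le> u \<bullet> b"
  have le': "l $ i \<le> u $ i" for i
    using le[of "axis i 1"] by (auto simp: inner_axis)
  have "emeasure (distr (PiM UNIV (\<lambda>_. lborel)) borel (\<lambda>f. \<chi> i. f i)) (box l u)
      = emeasure (PiM UNIV (\<lambda>_. lborel)) ((\<lambda>f. \<chi> i. f i) -` box l u \<inter> space (PiM UNIV (\<lambda>_::'n. lborel)))"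
    by (rule emeasure_distr) auto
  also have "(\<lambda>f. \<chi> i. f i) -` box l u \<inter> space (PiM UNIV (\<lambda>_::'n. lborel))
      = (\<Pi>\<^sub>E i\<in>UNIV. {l $ i <..< u $ i})"
    by (auto simp: mem_box_cart space_PiM PiE_iff)
  also have "emeasure (PiM UNIV (\<lambda>_. lborel)) \<dots> = (\<Prod>i\<in>UNIV. emeasure lborel {l $ i <..< u $ i})"
    by (rule lborel_PiM.emeasure_PiM) auto
  also have "\<dots> = ennreal (\<Prod>i\<in>UNIV. u $ i - l $ i)"
    using le' by (subst prod_ennreal[symmetric]) auto
  also have "(\<Prod>i\<in>UNIV. u $ i - l $ i) = (\<Prod>b\<in>Basis. (u - l) \<bullet> b)"
    by (simp add: prod_Basis_vec inner_axis)
  finally show "emeasure (distr (PiM UNIV (\<lambda>_. lborel)) borel (\<lambda>f. \<chi> i. f i)) (box l u)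
      = (\<Prod>b\<in>Basis. (u - l) \<bullet> b)" .
qed simp

lemma nn_integral_lborel_vec:
  fixes f :: "real ^ 'n \<Rightarrow> ennreal"
  assumes [measurable]: "f \<in> borel_measurable borel"
  shows "(\<integral>\<^sup>+x. f x \<partial>lborel) = (\<integral>\<^sup>+z. f (\<chi> i. z i) \<partial>PiM UNIV (\<lambda>_. lborel))"
  by (subst lborel_vec_eq_distr_PiM, subst nn_integral_distr) auto

section \<open>Fibres in a coordinate direction\<close>

abbreviation lborel_off :: "'n \<Rightarrow> ('n::finite \<Rightarrow> real) measure" where
  "lborel_off i \<equiv> PiM (- {i}) (\<lambda>_. lborel)"

definition proj_off :: "'n \<Rightarrow> real ^ 'n \<Rightarrow> 'n \<Rightarrow> real" where
  "proj_off i x = restrict (($) x) (- {i})"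

definition fibre_point :: "'n \<Rightarrow> ('n \<Rightarrow> real) \<Rightarrow> real \<Rightarrow> real ^ 'n" where
  "fibre_point i z y = (\<chi> j. (z(i := y)) j)"

lemma fibre_point_nth: "fibre_point i z y $ j = (if j = i then y else z j)"
  by (simp add: fibre_point_def)

lemma fibre_point_proj_off [simp]: "fibre_point i (proj_off i x) (x $ i) = x"
  by (simp add: vec_eq_iff fibre_point_nth proj_off_def)

lemma proj_off_fibre_point: "z \<in> space (lborel_off i) \<Longrightarrow> proj_off i (fibre_point i z y) = z"
  by (auto simp: proj_off_def fibre_point_nth fun_eq_iff space_PiM PiE_iff extensional_def)

lemma continuous_fibre_point: "continuous_on S (fibre_point i z)"
proof -
  have "continuous_on S (\<lambda>y. \<chi> j. if j = i then y else z j)"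
  proof (rule continuous_on_vec_lambda)
    fix j
    show "continuous_on S (\<lambda>y. if j = i then y else z j)"
      by (cases "j = i") simp_all
  qed
  moreover have "fibre_point i z = (\<lambda>y. \<chi> j. if j = i then y else z j)"
    by (simp add: fun_eq_iff vec_eq_iff fibre_point_nth)
  ultimately show ?thesis
    by simp
qed

lemma measurable_proj_off [measurable]: "proj_off i \<in> borel \<rightarrow>\<^sub>M lborel_off i"
  unfolding proj_off_def by (intro measurable_restrict) simp

lemma insert_Compl_self: "insert i (- {i}) = UNIV"
  by auto

lemma measurable_fibre_point [measurable]:
  "(\<lambda>(z, y). fibre_point i z y) \<in> lborel_off i \<Otimes>\<^sub>M lborel \<rightarrow>\<^sub>M borel"
  using measurable_compose[OF measurable_add_dim[of i "- {i}" "\<lambda>_. lborel"],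
      unfolded insert_Compl_self, OF measurable_vec_lambda_PiM]
  by (simp add: fibre_point_def split_def)

lemma nn_integral_lborel_fibres:
  fixes f :: "real ^ 'n \<Rightarrow> ennreal"
  assumes [measurable]: "f \<in> borel_measurable borel"
  shows "(\<integral>\<^sup>+x. f x \<partial>lborel) = (\<integral>\<^sup>+z. \<integral>\<^sup>+y. f (fibre_point i z y) \<partial>lborel \<partial>lborel_off i)"
proof -
  have "(\<lambda>z. f (\<chi> j. z j)) \<in> borel_measurable (PiM (insert i (- {i})) (\<lambda>_. lborel))"
    unfolding insert_Compl_self by measurable
  from lborel_PiM.product_nn_integral_insert[OF _ _ this] show ?thesis
    unfolding insert_Compl_self by (simp add: nn_integral_lborel_vec fibre_point_def)
qed

lemma AE_PiM_lborel_nonzero: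
  assumes "finite I"
  shows "AE z in PiM I (\<lambda>_. lborel :: real measure). \<forall>j\<in>I. z j \<noteq> 0"
proof (rule AE_finite_allI[OF assms])
  fix j
  assume "j \<in> I"
  let ?N = "\<Pi>\<^sub>E k\<in>I. if k = j then {0::real} else UNIV"
  have "emeasure (PiM I (\<lambda>_. lborel)) ?N = (\<Prod>k\<in>I. emeasure lborel (if k = j then {0::real} else UNIV))"
    by (rule lborel_PiM.emeasure_PiM[OF assms]) auto
  also have "\<dots> = 0"
    using assms \<open>j \<in> I\<close> by (intro prod_zero) auto
  finally have "?N \<in> null_sets (PiM I (\<lambda>_. lborel))"
    by (intro null_setsI sets_PiM_I_finite[OF assms]) auto
  then show "AE z in PiM I (\<lambda>_. lborel :: real measure). z j \<noteq> 0"
    by (rule AE_I') (auto simp: space_PiM PiE_iff extensional_def)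
qed

subsection \<open>Hausdorff measure dominates the measure of projections\<close>

text \<open>A set of diameter r projects into a cube of side 2r, whose Lebesgue measure is the Hausdorff
  gauge up to a factor.\<close>

lemma emeasure_le_hausdorff_outer_proj:
  fixes E :: "(real ^ 'n) set"
  defines "d \<equiv> CARD('n) - 1"
  assumes Q [measurable]: "Q \<in> sets (lborel_off i)" and sub: "Q \<subseteq> proj_off i ` E"
  shows "emeasure (lborel_off i) Q \<le> ennreal (4 ^ d / unit_ball_vol d) * hausdorff_outer d E"
proof -
  let ?\<kappa> = "4 ^ d / unit_ball_vol d"
  have vol: "0 < unit_ball_vol d"
    by simp
  have cover: "emeasure (lborel_off i) Q \<le> ennreal ?\<kappa> * (\<Sum>n. hausdorff_gauge d (C n))"
    if C: "\<And>n. bounded (C n)" "E \<subseteq> (\<Union>n. C n)" for C :: "nat \<Rightarrow> (real ^ 'n) set"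
  proof -
    define p where "p n = (SOME x. x \<in> C n)" for n
    define D where "D n = (if C n = {} then {} else
      (\<Pi>\<^sub>E j\<in>- {i}. {p n $ j - diameter (C n) .. p n $ j + diameter (C n)}))" for n
    have D_sets: "D n \<in> sets (lborel_off i)" for n
      by (auto simp: D_def intro!: sets_PiM_I_finite)
    have "emeasure (lborel_off i) (D n) = ennreal ?\<kappa> * hausdorff_gauge d (C n)" for n
    proof (cases "C n = {}")
      case False
      have \<delta>: "0 \<le> diameter (C n)"
        by (rule diameter_ge_0[OF C(1)])
      have "emeasure (lborel_off i) (D n)
          = (\<Prod>j\<in>- {i}. emeasure lborel {p n $ j - diameter (C n) .. p n $ j + diameter (C n)})"
        using False unfolding D_def by (simp add: lborel_PiM.emeasure_PiM)
      also have "\<dots> = (\<Prod>j\<in>- {i}. ennreal (2 * diameter (C n)))"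
        using \<delta> by (intro prod.cong refl) (simp add: algebra_simps)
      also have "\<dots> = ennreal ((2 * diameter (C n)) ^ d)"
        using \<delta> by (simp add: d_def Compl_eq_Diff_UNIV card_Diff_singleton ennreal_power
            del: ennreal_mult ennreal_mult')
      also have "(2 * diameter (C n)) ^ d = ?\<kappa> * (unit_ball_vol d * (diameter (C n) / 2) ^ d)"
      proof -
        have "?\<kappa> * (unit_ball_vol d * (diameter (C n) / 2) ^ d) = 4 ^ d * (diameter (C n) / 2) ^ d"
          using less_imp_neq[OF vol] by simp
        also have "\<dots> = (2 * diameter (C n)) ^ d"
          unfolding power_mult_distrib[symmetric] by simp
        finally show ?thesis
          by simp
      qed
      also have "ennreal \<dots> = ennreal ?\<kappa> * ennreal (unit_ball_vol d * (diameter (C n) / 2) ^ d)"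
        by (rule ennreal_mult) (use vol \<delta> in auto)
      finally show ?thesis
        using False by (simp only: hausdorff_gauge_def if_False)
    qed (simp add: D_def)
    moreover have "Q \<subseteq> (\<Union>n. D n)"
    proof
      fix z
      assume "z \<in> Q"
      then obtain x where x: "x \<in> E" "z = proj_off i x"
        using sub by auto
      then obtain n where n: "x \<in> C n"
        using C(2) by auto
      have "p n \<in> C n"
        unfolding p_def using n by (rule someI)
      then have "\<bar>x $ j - p n $ j\<bar> \<le> diameter (C n)" for j
        using diameter_bounded_bound[OF C(1) n, of "p n"] component_le_norm_cart[of "x - p n" j]
        by (simp add: dist_norm)
      then have "x $ j \<in> {p n $ j - diameter (C n) .. p n $ j + diameter (C n)}" for j
        by (auto simp: abs_le_iff algebra_simps)
      then show "z \<in> (\<Union>n. D n)"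
        using n x(2) by (intro UN_I[of n]) (auto simp: D_def proj_off_def)
    qed
    then have "emeasure (lborel_off i) Q \<le> (\<Sum>n. emeasure (lborel_off i) (D n))"
      using D_sets by (intro order_trans[OF emeasure_mono emeasure_subadditive_countably]) auto
    ultimately show ?thesis
      by simp
  qed
  have \<kappa>: "0 < ennreal ?\<kappa>"
    using vol by (simp only: ennreal_less_zero_iff) simp
  then have "emeasure (lborel_off i) Q = ennreal ?\<kappa> * (emeasure (lborel_off i) Q / ennreal ?\<kappa>)"
    by (simp only: ennreal_times_divide mult.commute[of "ennreal ?\<kappa>"] ennreal_mult_divide_eq
        ennreal_neq_top less_imp_neq[symmetric] not_False_eq_True)
  also have "\<dots> \<le> ennreal ?\<kappa> * hausdorff_premeasure d 1 E"
    unfolding hausdorff_premeasure_def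
    using \<kappa> by (intro mult_left_mono INF_greatest divide_le_posI_ennreal cover) auto
  also have "\<dots> \<le> ennreal ?\<kappa> * hausdorff_outer d E"
    by (intro mult_left_mono hausdorff_premeasure_le_outer) auto
  finally show ?thesis .
qed

subsection \<open>Suprema over fibres\<close>

text \<open>For open sets and continuous functions the supremum over the rational points of a fibre is
  the supremum over the whole fibre; the countable form makes measurability evident.\<close>

definition fibre_sup :: "'n \<Rightarrow> (real ^ 'n) set \<Rightarrow> (real ^ 'n \<Rightarrow> real) \<Rightarrow> ('n \<Rightarrow> real) \<Rightarrow> ennreal" where
  "fibre_sup i \<Omega> g z =
     (SUP y\<in>\<rat>. ennreal (g (fibre_point i z y)) * indicator \<Omega> (fibre_point i z y))"

lemma borel_measurable_fibre_sup:
  assumes [measurable]: "open \<Omega>" "g \<in> borel_measurable borel"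
  shows "fibre_sup i \<Omega> g \<in> borel_measurable (lborel_off i)"
proof -
  have [measurable]: "(\<lambda>z. fibre_point i z y) \<in> lborel_off i \<rightarrow>\<^sub>M borel" for y
  proof -
    have "(\<lambda>z. (z, y)) \<in> lborel_off i \<rightarrow>\<^sub>M lborel_off i \<Otimes>\<^sub>M lborel"
      by simp
    from measurable_compose[OF this measurable_fibre_point] show ?thesis
      by simp
  qed
  have [measurable]: "\<Omega> \<in> sets borel"
    using assms(1) by simp
  show ?thesis
    unfolding fibre_sup_def by (intro borel_measurable_SUP countable_rat) measurable
qed

text \<open>The points of a fibre that lie in \<Omega> and at which g exceeds a given bound form an open subset of
  the line, which contains a rational point if it is nonempty.\<close>

lemma fibre_sup_upper:
  assumes \<Omega>: "open \<Omega>" and g: "continuous_on UNIV g" and x: "x \<in> \<Omega>"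
  shows "ennreal (g x) \<le> fibre_sup i \<Omega> g (proj_off i x)"
proof (rule ccontr)
  assume "\<not> ?thesis"
  then have less: "fibre_sup i \<Omega> g (proj_off i x) < ennreal (g x)"
    by simp
  then obtain r where r: "0 \<le> r" "fibre_sup i \<Omega> g (proj_off i x) = ennreal r"
    by (cases "fibre_sup i \<Omega> g (proj_off i x)") auto
  let ?F = "fibre_point i (proj_off i x)"
  have "open {y. ?F y \<in> \<Omega> \<and> r < g (?F y)}"
  proof -
    have "open (?F -` \<Omega>)"
      by (rule open_vimage[OF \<Omega> continuous_fibre_point])
    moreover have "open {y. r < g (?F y)}"
      by (intro open_Collect_less continuous_on_const continuous_on_compose2[OF g continuous_fibre_point]) auto
    ultimately have "open (?F -` \<Omega> \<inter> {y. r < g (?F y)})"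
      by (rule open_Int)
    then show ?thesis
      by (simp add: vimage_def Int_def)
  qed
  moreover have "x $ i \<in> {y. ?F y \<in> \<Omega> \<and> r < g (?F y)}"
    using x less r by (auto simp: ennreal_less_iff)
  ultimately obtain e where e: "0 < e" "ball (x $ i) e \<subseteq> {y. ?F y \<in> \<Omega> \<and> r < g (?F y)}"
    by (meson open_contains_ball)
  obtain q where q: "q \<in> \<rat>" "x $ i < q" "q < x $ i + e"
    using Rats_dense_in_real[of "x $ i" "x $ i + e"] e(1) by auto
  then have Fq: "?F q \<in> \<Omega>" "r < g (?F q)"
    using e(2) by (auto simp: dist_real_def subset_eq)
  have "ennreal (g (?F q)) * indicator \<Omega> (?F q) \<le> fibre_sup i \<Omega> g (proj_off i x)"
    unfolding fibre_sup_def using q(1) by (rule SUP_upper)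
  then show False
    using Fq r by (simp add: ennreal_le_iff2)
qed

text \<open>Outside a null set of fibres, every point of \<Omega> has boundary points of \<Omega> further out on its
  fibre, where g is at least as large. Hence each superlevel set of the fibre supremum lies in the
  projection of a superlevel set of g on the boundary, and summing over the values of simple
  functions below the supremum bounds its integral. The factor 2 leaves room because a value of a
  simple function may coincide with a supremum that is not attained.\<close>

lemma nn_integral_fibre_sup_le:
  fixes \<Omega> :: "(real ^ 'n) set"
  defines "d \<equiv> CARD('n) - 1"
  assumes \<Omega>: "open \<Omega>" and g: "continuous_on UNIV g"
    and mono: "\<And>z y y'. \<bar>y\<bar> \<le> \<bar>y'\<bar> \<Longrightarrow> g (fibre_point i z y) \<le> g (fibre_point i z y')"
    and exits: "AE z in lborel_off i. \<forall>t. (\<exists>y\<ge>t. fibre_point i z y \<notin> \<Omega>) \<and> (\<exists>y\<le>t. fibre_point i z y \<notin> \<Omega>)"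
  shows "(\<integral>\<^sup>+z. fibre_sup i \<Omega> g z \<partial>lborel_off i)
    \<le> ennreal (2 * (4 ^ d / unit_ball_vol d)) * (\<integral>\<^sup>+x\<in>frontier \<Omega>. ennreal (g x) \<partial>hausdorff_measure d)"
proof -
  let ?M = "lborel_off i"
  let ?H = "hausdorff_measure d :: (real ^ 'n) measure"
  let ?G = "fibre_sup i \<Omega> g"
  define \<kappa> where "\<kappa> = 4 ^ d / unit_ball_vol d"
  have \<kappa>: "0 < \<kappa>"
    by (simp add: \<kappa>_def)
  have g_meas [measurable]: "g \<in> borel_measurable borel"
    using g by (rule borel_measurable_continuous_onI)
  obtain N where N: "N \<in> null_sets ?M"
    and exit: "\<And>z t. z \<in> space ?M \<Longrightarrow> z \<notin> N \<Longrightarrow>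
      (\<exists>y\<ge>t. fibre_point i z y \<notin> \<Omega>) \<and> (\<exists>y\<le>t. fibre_point i z y \<notin> \<Omega>)"
    using exits unfolding eventually_ae_filter by blast
  have fr: "frontier \<Omega> \<in> sets borel"
    by (intro borel_closed) simp
  have simple: "integral\<^sup>S ?M s \<le> ennreal (2 * \<kappa>) * (\<integral>\<^sup>+x\<in>frontier \<Omega>. ennreal (g x) \<partial>?H)"
    if s: "simple_function ?M s" "s \<le> ?G" "\<And>z. s z < top" for s
  proof -
    let ?V = "s ` space ?M"
    define Q where "Q v = (s -` {v} \<inter> space ?M) - N" for v
    define E where "E v = {x \<in> frontier \<Omega>. proj_off i x \<in> Q v \<and> v < 2 * ennreal (g x)}" for v
    have Q_sets [measurable]: "Q v \<in> sets ?M" for v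
      using s(1) N by (auto simp: Q_def intro!: sets.Diff simple_functionD)
    have E_sets [measurable]: "E v \<in> sets borel" for v
    proof -
      have "E v = frontier \<Omega> \<inter> ((proj_off i -` Q v \<inter> space borel) \<inter> {x \<in> space borel. v < 2 * ennreal (g x)})"
        by (auto simp: E_def)
      also have "\<dots> \<in> sets borel"
        by (intro sets.Int fr measurable_sets[OF measurable_proj_off Q_sets]) measurable
      finally show ?thesis .
    qed
    have term_le: "v * emeasure ?M (s -` {v} \<inter> space ?M)
        \<le> ennreal (2 * \<kappa>) * (\<integral>\<^sup>+x. ennreal (g x) * indicator (E v) x \<partial>?H)" if v: "v \<in> ?V" for v
    proof (cases "v = 0")
      case False
      have v_fin: "v < top"
        using v s(3) by auto
      have "Q v \<subseteq> proj_off i ` E v"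
      proof
        fix z
        assume "z \<in> Q v"
        then have z: "z \<in> space ?M" "z \<notin> N" "s z = v"
          by (auto simp: Q_def)
        have "v \<le> ?G z"
          using s(2) z(3) by (auto simp: le_fun_def)
        have v2: "2 * (v / 2) = v"
          using v_fin by (cases v)
            (auto simp: divide_ennreal ennreal_mult[symmetric] simp flip: ennreal_numeral)
        note \<open>v \<le> ?G z\<close>
        moreover have "v / 2 < v"
          using False v_fin by (cases v)
            (auto simp: divide_ennreal ennreal_less_iff ennreal_eq_0_iff
              simp flip: ennreal_numeral)
        ultimately have "v / 2 < ?G z"
          by (rule less_le_trans[rotated])
        then obtain y where "v / 2 < ennreal (g (fibre_point i z y)) * indicator \<Omega> (fibre_point i z y)"
          unfolding fibre_sup_def less_SUP_iff by blast
        then have y: "fibre_point i z y \<in> \<Omega>" "v / 2 < ennreal (g (fibre_point i z y))"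
          by (auto split: split_indicator_asm)
        \<comment> \<open>Moving away from the coordinate hyperplane, the fibre leaves \<Omega>.\<close>
        obtain y' where y': "fibre_point i z y' \<notin> \<Omega>" "0 \<le> y \<and> y \<le> y' \<or> y \<le> 0 \<and> y' \<le> y"
          using exit[OF z(1,2), of y] by (metis linear)
        have "connected (fibre_point i z ` closed_segment y y')"
          by (intro connected_continuous_image continuous_fibre_point) auto
        then have "fibre_point i z ` closed_segment y y' \<inter> frontier \<Omega> \<noteq> {}"
          by (rule connected_Int_frontier) (use y(1) y'(1) in auto)
        then obtain y'' where y'': "y'' \<in> closed_segment y y'" "fibre_point i z y'' \<in> frontier \<Omega>"
          by blast
        then have "\<bar>y\<bar> \<le> \<bar>y''\<bar>"
          using y'(2) by (auto simp: closed_segment_eq_real_ivl split: if_splits)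
        then have "v / 2 < ennreal (g (fibre_point i z y''))"
          using y(2) mono[of y y'' z] by (meson ennreal_leI less_le_trans)
        then have "v < 2 * ennreal (g (fibre_point i z y''))"
          using ennreal_mult_strict_left_mono[of "v / 2" _ 2] v2 by simp
        then show "z \<in> proj_off i ` E v"
          using y''(2) \<open>z \<in> Q v\<close> z(1)
          by (intro image_eqI[of _ _ "fibre_point i z y''"]) (auto simp: E_def proj_off_fibre_point)
      qed
      then have "emeasure ?M (Q v) \<le> ennreal \<kappa> * emeasure ?H (E v)"
        using emeasure_le_hausdorff_outer_proj[OF Q_sets, of v "E v"]
        by (simp add: \<kappa>_def d_def emeasure_hausdorff_measure)
      moreover have "emeasure ?M (s -` {v} \<inter> space ?M) = emeasure ?M (Q v)"
        unfolding Q_def using N s(1) by (intro emeasure_Diff_null_set[symmetric]) (auto intro: simple_functionD)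
      ultimately have "v * emeasure ?M (s -` {v} \<inter> space ?M) \<le> ennreal \<kappa> * (v * emeasure ?H (E v))"
        by (simp add: mult.left_commute mult_left_mono)
      also have "v * emeasure ?H (E v) = (\<integral>\<^sup>+x. v * indicator (E v) x \<partial>?H)"
        by (simp add: nn_integral_cmult_indicator)
      also have "\<dots> \<le> (\<integral>\<^sup>+x. 2 * (ennreal (g x) * indicator (E v) x) \<partial>?H)"
        by (intro nn_integral_mono) (auto simp: E_def indicator_def intro: less_imp_le)
      also have "\<dots> = 2 * (\<integral>\<^sup>+x. ennreal (g x) * indicator (E v) x \<partial>?H)"
        by (rule nn_integral_cmult) measurable
      also have "ennreal \<kappa> * \<dots> = ennreal (2 * \<kappa>) * (\<integral>\<^sup>+x. ennreal (g x) * indicator (E v) x \<partial>?H)"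
        using \<kappa> by (simp add: ennreal_mult ac_simps)
      finally show ?thesis
        by (simp add: mult_left_mono)
    qed simp
    have "integral\<^sup>S ?M s = (\<Sum>v\<in>?V. v * emeasure ?M (s -` {v} \<inter> space ?M))"
      by (rule simple_integral_def)
    also have "\<dots> \<le> (\<Sum>v\<in>?V. ennreal (2 * \<kappa>) * (\<integral>\<^sup>+x. ennreal (g x) * indicator (E v) x \<partial>?H))"
      by (rule sum_mono) (rule term_le)
    also have "\<dots> = ennreal (2 * \<kappa>) * (\<integral>\<^sup>+x. (\<Sum>v\<in>?V. ennreal (g x) * indicator (E v) x) \<partial>?H)"
      by (subst nn_integral_sum) (auto simp: sum_distrib_left)
    also have "\<dots> \<le> ennreal (2 * \<kappa>) * (\<integral>\<^sup>+x\<in>frontier \<Omega>. ennreal (g x) \<partial>?H)"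
    proof (intro mult_left_mono nn_integral_mono)
      fix x
      \<comment> \<open>The sets E v are disjoint, since s takes only one value at the projection of x.\<close>
      have "(\<Sum>v\<in>?V. ennreal (g x) * indicator (E v) x)
          \<le> (\<Sum>v\<in>?V. if v = s (proj_off i x) then ennreal (g x) * indicator (frontier \<Omega>) x else 0)"
        by (rule sum_mono) (auto simp: E_def Q_def split: split_indicator)
      also have "\<dots> \<le> ennreal (g x) * indicator (frontier \<Omega>) x"
        using simple_functionD(1)[OF s(1)] by simp
      finally show "(\<Sum>v\<in>?V. ennreal (g x) * indicator (E v) x) \<le> ennreal (g x) * indicator (frontier \<Omega>) x" .
    qed simp
    finally show ?thesis .
  qed
  show ?thesis
    unfolding nn_integral_def_finite[of ?M] \<kappa>_def[symmetric] using simple by (intro SUP_least) auto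
qed

section \<open>Monomial weights\<close>

definition coord_weight :: "real \<Rightarrow> real \<Rightarrow> real" where
  "coord_weight a t = (if a = 0 then 1 else \<bar>t\<bar> powr a)"

lemma monomial_weight_eq: "monomial_weight A x = (\<Prod>i\<in>UNIV. coord_weight (A $ i) (x $ i))"
  by (simp add: monomial_weight_def coord_weight_def)

lemma coord_weight_nonneg [simp]: "0 \<le> coord_weight a t"
  by (simp add: coord_weight_def)

lemma coord_weight_pos: "t \<noteq> 0 \<Longrightarrow> 0 < coord_weight a t"
  by (simp add: coord_weight_def)

lemma coord_weight_eq_powr: "t \<noteq> 0 \<Longrightarrow> coord_weight a t = \<bar>t\<bar> powr a"
  by (simp add: coord_weight_def)

lemma coord_weight_mono: "0 \<le> a \<Longrightarrow> \<bar>s\<bar> \<le> \<bar>t\<bar> \<Longrightarrow> coord_weight a s \<le> coord_weight a t"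
  by (simp add: coord_weight_def powr_mono2)

lemma continuous_on_coord_weight: "0 \<le> a \<Longrightarrow> continuous_on S (coord_weight a)"
proof (cases "a = 0")
  case False
  assume "0 \<le> a"
  with False have "continuous_on S (\<lambda>t. \<bar>t\<bar> powr a)"
    by (intro continuous_on_powr' continuous_intros) auto
  with False show ?thesis
    by (simp add: coord_weight_def[abs_def])
qed (simp add: coord_weight_def[abs_def])

lemma monomial_weight_nonneg [simp]: "0 \<le> monomial_weight A x"
  by (simp add: monomial_weight_eq prod_nonneg)

lemma continuous_on_monomial_weight:
  assumes "\<And>i. 0 \<le> A $ i"
  shows "continuous_on S (monomial_weight A)"
proof -
  have "continuous_on S (\<lambda>x. \<Prod>i\<in>UNIV. coord_weight (A $ i) (x $ i))"
    by (intro continuous_on_prod continuous_on_compose2[OF continuous_on_coord_weight[of _ UNIV]]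
        continuous_intros assms) auto
  then show ?thesis
    by (simp add: monomial_weight_eq[abs_def])
qed

lemma borel_measurable_monomial_weight:
  "(\<And>i. 0 \<le> A $ i) \<Longrightarrow> monomial_weight A \<in> borel_measurable borel"
  by (intro borel_measurable_continuous_onI continuous_on_monomial_weight)

lemma monomial_weight_fibre_point:
  "monomial_weight A (fibre_point i z y)
    = (\<Prod>j\<in>- {i}. coord_weight (A $ j) (z j)) * coord_weight (A $ i) y"
proof -
  have "monomial_weight A (fibre_point i z y)
      = (\<Prod>j\<in>insert i (- {i}). coord_weight (A $ j) (fibre_point i z y $ j))"
    by (simp only: monomial_weight_eq insert_Compl_self)
  also have "\<dots> = coord_weight (A $ i) y * (\<Prod>j\<in>- {i}. coord_weight (A $ j) (z j))"
    by (subst prod.insert) (auto simp: fibre_point_nth intro!: prod.cong)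
  finally show ?thesis
    by (simp add: mult.commute)
qed

lemma monomial_weight_eq_exp:
  assumes "\<And>i. x $ i \<noteq> 0"
  shows "monomial_weight A x = exp (\<Sum>i\<in>UNIV. A $ i * ln \<bar>x $ i\<bar>)"
  using assms by (simp add: monomial_weight_eq coord_weight_eq_powr exp_sum powr_def)

lemma emeasure_lborel_unbounded_intervals:
  fixes R :: "real set"
  assumes "R \<in> sets borel" "\<And>n::nat. \<exists>l. {l..l + real n} \<subseteq> R"
  shows "emeasure lborel R = \<infinity>"
proof (rule ccontr)
  assume "emeasure lborel R \<noteq> \<infinity>"
  then obtain r where r: "0 \<le> r" "emeasure lborel R = ennreal r"
    by (cases "emeasure lborel R") auto
  obtain n where n: "r < real n"
    using reals_Archimedean2 by blast
  obtain l where "{l..l + real n} \<subseteq> R"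
    using assms(2) by blast
  then have "emeasure lborel {l..l + real n} \<le> emeasure lborel R"
    using assms(1) by (intro emeasure_mono) auto
  with r n show False
    by (simp add: ennreal_le_iff2)
qed

text \<open>A half-line has infinite mass for every weight with nonnegative exponent, so a set of finite
  weighted volume contains half-lines only over a null set.\<close>

lemma AE_fibre_exits:
  fixes \<Omega> :: "(real ^ 'n) set"
  assumes \<Omega>: "open \<Omega>" and B: "\<And>i. 0 \<le> B $ i" and fin: "weighted_volume B \<Omega> < \<infinity>"
  shows "AE z in lborel_off i.
    \<forall>t. (\<exists>y\<ge>t. fibre_point i z y \<notin> \<Omega>) \<and> (\<exists>y\<le>t. fibre_point i z y \<notin> \<Omega>)"
proof -
  let ?F = "\<lambda>x. ennreal (monomial_weight B x) * indicator \<Omega> x"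
  have [measurable]: "\<Omega> \<in> sets borel" "monomial_weight B \<in> borel_measurable borel"
    using \<Omega> B by (auto intro: borel_measurable_monomial_weight)
  have "(\<integral>\<^sup>+z. \<integral>\<^sup>+y. ?F (fibre_point i z y) \<partial>lborel \<partial>lborel_off i) \<noteq> \<infinity>"
    using fin by (subst nn_integral_lborel_fibres[symmetric]) (auto simp: weighted_volume_def)
  then have "AE z in lborel_off i. (\<integral>\<^sup>+y. ?F (fibre_point i z y) \<partial>lborel) \<noteq> \<infinity>"
    by (rule nn_integral_PInf_AE[rotated]) measurable
  moreover have "AE z in lborel_off i. \<forall>j\<in>- {i}. z j \<noteq> 0"
    by (rule AE_PiM_lborel_nonzero) simp
  ultimately show ?thesis
  proof eventually_elim
    case (elim z)
    define w where "w = (\<Prod>j\<in>- {i}. coord_weight (B $ j) (z j))"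
    have w: "0 < w"
      using elim(2) by (auto simp: w_def intro!: prod_pos coord_weight_pos)
    have escape: "\<exists>y\<in>R. fibre_point i z y \<notin> \<Omega>"
      if R: "R \<in> sets borel" "emeasure lborel R = \<infinity>" "\<And>y. y \<in> R \<Longrightarrow> 1 \<le> \<bar>y\<bar>" for R
    proof (rule ccontr)
      assume "\<not> ?thesis"
      then have in_\<Omega>: "fibre_point i z y \<in> \<Omega>" if "y \<in> R" for y
        using that by auto
      have "(\<integral>\<^sup>+y. ennreal w * indicator R y \<partial>lborel) \<le> (\<integral>\<^sup>+y. ?F (fibre_point i z y) \<partial>lborel)"
      proof (rule nn_integral_mono)
        fix y
        have "w \<le> w * coord_weight (B $ i) y" if "y \<in> R"
          using w B[of i] R(3)[OF that] by (auto simp: coord_weight_def intro!: ge_one_powr_ge_zero)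
        then show "ennreal w * indicator R y \<le> ?F (fibre_point i z y)"
          using in_\<Omega>[of y]
          by (auto simp: monomial_weight_fibre_point w_def[symmetric] indicator_def intro!: ennreal_leI)
      qed
      also have "(\<integral>\<^sup>+y. ennreal w * indicator R y \<partial>lborel) = \<infinity>"
        using R w by (simp add: nn_integral_cmult_indicator ennreal_mult_top ennreal_eq_0_iff)
      finally show False
        using elim(1) by (simp add: top_unique)
    qed
    have up: "\<exists>y\<ge>t. fibre_point i z y \<notin> \<Omega>" for t
    proof -
      have "\<exists>l. {l..l + real n} \<subseteq> {max t 1..}" for n
        by (rule exI[of _ "max t 1"]) auto
      then have "emeasure lborel {max t 1..} = \<infinity>"
        by (rule emeasure_lborel_unbounded_intervals[rotated]) simp
      then show ?thesis
        using escape[of "{max t 1..}"] by auto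
    qed
    have down: "\<exists>y\<le>t. fibre_point i z y \<notin> \<Omega>" for t
    proof -
      have "\<exists>l. {l..l + real n} \<subseteq> {..min t (- 1)}" for n
        by (rule exI[of _ "min t (- 1) - real n"]) auto
      then have "emeasure lborel {..min t (- 1)} = \<infinity>"
        by (rule emeasure_lborel_unbounded_intervals[rotated]) simp
      then show ?thesis
        using escape[of "{..min t (- 1)}"] by auto
    qed
    show ?case
      using up down by blast
  qed
qed

lemma nn_integral_abs_powr_le:
  fixes a S :: real
  assumes a: "0 < a" and S: "0 \<le> S"
  shows "(\<integral>\<^sup>+y. ennreal (\<bar>y\<bar> powr (a - 1)) * indicator {-S..S} y \<partial>lborel) \<le> ennreal (2 * (S powr a / a))"
proof -
  have half: "(\<integral>\<^sup>+y. ennreal (indicator {0..S} y * y powr (a - 1)) \<partial>lborel) = ennreal (S powr a / a)"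
    using nn_integral_has_integral_lebesgue[OF _ has_integral_powr_from_0[of "a - 1" S]] a S by simp
  also have "(\<integral>\<^sup>+y. ennreal (indicator {0..S} y * y powr (a - 1)) \<partial>lborel)
      = (\<integral>\<^sup>+y. ennreal (indicator {0..S} (- y) * (- y) powr (a - 1)) \<partial>lborel)"
    using nn_integral_real_affine[of "\<lambda>y. ennreal (indicator {0..S} y * y powr (a - 1))" "-1" 0]
    by simp
  finally have half': "(\<integral>\<^sup>+y. ennreal (indicator {0..S} (- y) * (- y) powr (a - 1)) \<partial>lborel)
      = ennreal (S powr a / a)" .
  have "(\<integral>\<^sup>+y. ennreal (\<bar>y\<bar> powr (a - 1)) * indicator {-S..S} y \<partial>lborel)
      \<le> (\<integral>\<^sup>+y. ennreal (indicator {0..S} y * y powr (a - 1))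
          + ennreal (indicator {0..S} (- y) * (- y) powr (a - 1)) \<partial>lborel)"
    by (rule nn_integral_mono) (auto simp: indicator_def)
  also have "\<dots> = ennreal (S powr a / a) + ennreal (S powr a / a)"
    by (subst nn_integral_add) (auto simp: half half')
  also have "\<dots> = ennreal (2 * (S powr a / a))"
    using a by (subst ennreal_plus[symmetric]) auto
  finally show ?thesis .
qed

text \<open>On a fibre the weight is w|y|^a. It does not exceed the supremum G, so the fibre of \<Omega> lies
  in the interval of radius S with wS^a = G, and integrating w|y|^(a-1) over this interval
  gives 2G/a.\<close>

lemma nn_integral_fibre_Hardy:
  fixes \<Omega> :: "(real ^ 'n) set"
  assumes \<Omega>: "open \<Omega>" and A: "\<And>i. 0 \<le> A $ i" and a: "0 < A $ i"
    and z: "z \<in> space (lborel_off i)"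
  shows "(\<integral>\<^sup>+y. ennreal (monomial_weight A (fibre_point i z y) / \<bar>y\<bar>) * indicator \<Omega> (fibre_point i z y) \<partial>lborel)
    \<le> ennreal (2 / A $ i) * fibre_sup i \<Omega> (monomial_weight A) z"
proof -
  define w where "w = (\<Prod>j\<in>- {i}. coord_weight (A $ j) (z j))"
  define a where "a = A $ i"
  have w: "0 \<le> w"
    by (simp add: w_def prod_nonneg)
  have a0: "0 < a"
    using \<open>0 < A $ i\<close> by (simp add: a_def)
  have weight: "monomial_weight A (fibre_point i z y) = w * \<bar>y\<bar> powr a" for y
    using a0 by (simp add: monomial_weight_fibre_point w_def a_def coord_weight_def)
  have quot: "w * \<bar>y\<bar> powr a / \<bar>y\<bar> = w * \<bar>y\<bar> powr (a - 1)" for y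
    by (simp add: powr_diff)
  consider "w = 0" | "fibre_sup i \<Omega> (monomial_weight A) z = top"
    | r where "0 < w" "0 \<le> r" "fibre_sup i \<Omega> (monomial_weight A) z = ennreal r"
    using w by (cases "fibre_sup i \<Omega> (monomial_weight A) z") (auto simp: le_less)
  then show ?thesis
  proof cases
    case 1
    then show ?thesis
      by (simp add: weight)
  next
    case 2
    then show ?thesis
      using a0 by (simp add: a_def[symmetric] ennreal_mult_top ennreal_eq_0_iff)
  next
    case 3
    define S where "S = (r / w) powr (1 / a)"
    have S: "0 \<le> S" "w * S powr a = r"
      using 3 a0 by (auto simp: S_def powr_powr)
    have inside: "\<bar>y\<bar> \<le> S" if "fibre_point i z y \<in> \<Omega>" for y
    proof -
      have "ennreal (w * \<bar>y\<bar> powr a) \<le> ennreal r"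
        using fibre_sup_upper[OF \<Omega> continuous_on_monomial_weight that, of A i] A 3(3)
        by (simp add: weight proj_off_fibre_point[OF z])
      then have "\<bar>y\<bar> powr a \<le> r / w"
        using 3 by (simp add: field_simps)
      then have "(\<bar>y\<bar> powr a) powr (1 / a) \<le> S"
        unfolding S_def using a0 by (intro powr_mono2) auto
      then show ?thesis
        using a0 by (simp add: powr_powr)
    qed
    have "(\<integral>\<^sup>+y. ennreal (monomial_weight A (fibre_point i z y) / \<bar>y\<bar>) * indicator \<Omega> (fibre_point i z y) \<partial>lborel)
        \<le> (\<integral>\<^sup>+y. ennreal w * (ennreal (\<bar>y\<bar> powr (a - 1)) * indicator {-S..S} y) \<partial>lborel)"
      using inside w by (intro nn_integral_mono)
        (auto simp: weight quot indicator_def abs_le_iff ennreal_mult minus_le_iff)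
    also have "\<dots> = ennreal w * (\<integral>\<^sup>+y. ennreal (\<bar>y\<bar> powr (a - 1)) * indicator {-S..S} y \<partial>lborel)"
      by (rule nn_integral_cmult) measurable
    also have "\<dots> \<le> ennreal w * ennreal (2 * (S powr a / a))"
      by (intro mult_left_mono nn_integral_abs_powr_le a0 S) simp
    also have "\<dots> = ennreal (2 / a * (w * S powr a))"
      using w a0 by (simp add: ennreal_mult[symmetric] field_simps)
    also have "\<dots> = ennreal (2 / a) * ennreal r"
      unfolding S(2) using a0 3 by (intro ennreal_mult) auto
    finally show ?thesis
      using 3 by (simp add: a_def)
  qed
qed

section \<open>The isoperimetric inequality\<close>

text \<open>The pointwise factorization behind the use of Finner's inequality: with
  \<open>\<tau> = A - rB\<close>, the weight of the volume is a product of powers of the weight \<open>g = x\<^sup>A\<close> of the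
  perimeter and of the Hardy weights \<open>g/|x\<^sub>k|\<close>.\<close>

lemma monomial_weight_factorization:
  fixes A B x :: "real ^ 'n"
  assumes r: "0 < r"
    and scal: "r * (real CARD('n) + (\<Sum>i\<in>UNIV. B $ i)) = real CARD('n) + (\<Sum>i\<in>UNIV. A $ i) - 1"
    and x: "\<And>i. x $ i \<noteq> 0"
  defines "g \<equiv> monomial_weight A x"
  shows "monomial_weight B x = g powr ((1 - r) / r * real CARD('n))
    * (\<Prod>k\<in>UNIV. (g / \<bar>x $ k\<bar>) powr ((A $ k - r * B $ k) / r))"
proof -
  define L where "L i = ln \<bar>x $ i\<bar>" for i
  define S where "S = (\<Sum>i\<in>UNIV. A $ i * L i)"
  have g: "g = exp S"
    using monomial_weight_eq_exp[OF x, of A] by (simp add: g_def S_def L_def)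
  have abs: "\<bar>x $ k\<bar> = exp (L k)" for k
    using x[of k] by (simp add: L_def)
  define \<sigma> where "\<sigma> k = (A $ k - r * B $ k) / r" for k
  define \<rho> where "\<rho> = (1 - r) / r * real CARD('n)"
  have "(\<Sum>k\<in>UNIV. A $ k - r * B $ k) = 1 - (1 - r) * real CARD('n)"
    using scal by (simp add: sum_subtractf sum_distrib_left[symmetric] algebra_simps)
  then have total: "\<rho> + (\<Sum>k\<in>UNIV. \<sigma> k) = 1 / r"
    using r by (simp add: \<rho>_def \<sigma>_def sum_divide_distrib[symmetric] add_divide_distrib[symmetric])
  have "g powr \<rho> * (\<Prod>k\<in>UNIV. (g / \<bar>x $ k\<bar>) powr \<sigma> k)
      = exp (\<rho> * S + (\<Sum>k\<in>UNIV. \<sigma> k * (S - L k)))"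
    by (simp add: g abs exp_diff[symmetric] powr_def exp_sum exp_add)
  also have "\<rho> * S + (\<Sum>k\<in>UNIV. \<sigma> k * (S - L k)) = (\<rho> + (\<Sum>k\<in>UNIV. \<sigma> k)) * S - (\<Sum>k\<in>UNIV. \<sigma> k * L k)"
    by (simp add: distrib_right right_diff_distrib sum_subtractf sum_distrib_right)
  also have "\<dots> = (\<Sum>k\<in>UNIV. A $ k / r * L k - \<sigma> k * L k)"
    unfolding total by (simp add: S_def sum_subtractf sum_distrib_left)
  also have "\<dots> = (\<Sum>k\<in>UNIV. B $ k * L k)"
    using r by (intro sum.cong refl) (simp add: \<sigma>_def field_simps)
  also have "exp \<dots> = monomial_weight B x"
    using monomial_weight_eq_exp[OF x, of B] by (simp add: L_def)
  finally show ?thesis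
    by (simp add: \<rho>_def \<sigma>_def)
qed

text \<open>The functions of Finner's inequality are indexed by a disjoint sum: \<open>Inl i\<close> is the fibre
  supremum in direction i, which depends on the coordinates other than i, and \<open>Inr k\<close> is the
  Hardy weight in direction k, which depends on all coordinates. Indices with exponent 0
  are left out. The scaling relation between r, A and B says that the exponents of the functions
  depending on a given coordinate sum to 1, and that all exponents sum to 1/r.\<close>

lemma weighted_volume_le_perimeter_powr:
  fixes A B :: "real ^ 'n"
  assumes A: "\<And>i. 0 \<le> A $ i" and B: "\<And>i. 0 \<le> B $ i" and r: "0 < r" "r \<le> 1"
    and \<tau>: "\<And>i. 0 \<le> A $ i - r * B $ i"
    and scal: "r * (real CARD('n) + (\<Sum>i\<in>UNIV. B $ i)) = real CARD('n) + (\<Sum>i\<in>UNIV. A $ i) - 1"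
  obtains K where "0 < K"
    "\<And>\<Omega>. open \<Omega> \<Longrightarrow> weighted_volume B \<Omega> < \<infinity> \<Longrightarrow>
      weighted_volume B \<Omega> \<le> epowr (ennreal K * weighted_perimeter A \<Omega>) (1 / r)"
proof -
  define g where "g = monomial_weight A"
  define \<kappa> where "\<kappa> = 2 * (4 ^ (CARD('n) - 1) / unit_ball_vol (real (CARD('n) - 1)))"
  \<comment> \<open>K bounds both \<open>\<kappa>\<close>, the constant for the fibre suprema, and each Hardy constant \<open>2\<kappa>/a\<^sub>k\<close>;
    a vanishing entry of A contributes \<open>2/0 = 0\<close> to the sum.\<close>
  define K where "K = \<kappa> * (1 + (\<Sum>k\<in>UNIV. 2 / A $ k))"
  define \<rho> where "\<rho> = (1 - r) / r"
  define \<sigma> where "\<sigma> k = (A $ k - r * B $ k) / r" for k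
  have \<kappa>: "0 < \<kappa>"
    by (simp add: \<kappa>_def)
  have sum_nonneg: "0 \<le> (\<Sum>k\<in>UNIV. 2 / A $ k)"
    using A by (intro sum_nonneg) auto
  then have K: "0 < K" "\<kappa> \<le> K"
    using \<kappa> mult_left_mono[of 1 "1 + (\<Sum>k\<in>UNIV. 2 / A $ k)" \<kappa>]
    by (auto simp: K_def intro!: mult_pos_pos add_pos_nonneg)
  have K_Hardy: "2 / A $ k * \<kappa> \<le> K" for k
  proof -
    have "2 / A $ k \<le> (\<Sum>k\<in>UNIV. 2 / A $ k)"
      using A by (intro member_le_sum) auto
    then have "\<kappa> * (2 / A $ k) \<le> K"
      unfolding K_def using \<kappa> by (intro mult_left_mono) auto
    then show ?thesis
      by (simp add: mult.commute)
  qed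
  have \<rho>: "0 \<le> \<rho>" and \<sigma>: "0 \<le> \<sigma> k" for k
    using r \<tau> by (auto simp: \<rho>_def \<sigma>_def)
  have "(\<Sum>k\<in>UNIV. A $ k - r * B $ k) = 1 - (1 - r) * real CARD('n)"
    using scal by (simp add: sum_subtractf sum_distrib_left[symmetric] algebra_simps)
  then have total: "real CARD('n) * \<rho> + (\<Sum>k\<in>UNIV. \<sigma> k) = 1 / r"
    using r by (simp add: \<rho>_def \<sigma>_def sum_divide_distrib[symmetric] add_divide_distrib[symmetric] algebra_simps)
  define L where "L = {i::'n. 0 < \<rho>}"
  define T where "T = {k. 0 < \<sigma> k}"
  define J where "J = Inl ` L \<union> Inr ` T"
  define p where "p = case_sum (\<lambda>_::'n. \<rho>) \<sigma>"
  define D where "D = case_sum (\<lambda>i::'n. - {i}) (\<lambda>_::'n. UNIV)"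
  have J: "finite J"
    by (simp add: J_def)
  have p: "0 < p j" if "j \<in> J" for j
    using that by (auto simp: J_def L_def T_def p_def split: if_splits)
  have prod_J: "prod h J = (\<Prod>i\<in>L. h (Inl i)) * (\<Prod>k\<in>T. h (Inr k))" for h :: "'n + 'n \<Rightarrow> 'x::comm_monoid_mult"
    unfolding J_def by (subst prod.union_disjoint) (auto simp: prod.reindex)
  have sum_T: "sum \<sigma> T = (\<Sum>k\<in>UNIV. \<sigma> k)"
    using \<sigma> by (intro sum.mono_neutral_left) (auto simp: T_def le_less)
  have p_total: "(\<Sum>j\<in>J. p j) = 1 / r"
  proof -
    have "(\<Sum>j\<in>J. p j) = real (card L) * \<rho> + sum \<sigma> T"
      unfolding J_def by (subst sum.union_disjoint) (auto simp: sum.reindex p_def)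
    also have "real (card L) * \<rho> = real CARD('n) * \<rho>"
      using \<rho> by (auto simp: L_def le_less)
    finally show ?thesis
      using total by (simp add: sum_T)
  qed
  have p_coord: "(\<Sum>j | j \<in> J \<and> i \<in> D j. p j) = 1" for i
  proof -
    have "{j. j \<in> J \<and> i \<in> D j} = Inl ` (L - {i}) \<union> Inr ` T"
      by (auto simp: J_def D_def)
    then have "(\<Sum>j | j \<in> J \<and> i \<in> D j. p j) = real (card (L - {i})) * \<rho> + sum \<sigma> T"
      by (simp, subst sum.union_disjoint) (auto simp: sum.reindex p_def)
    also have "real (card (L - {i})) * \<rho> = (real CARD('n) - 1) * \<rho>"
      using \<rho> by (auto simp: L_def le_less card_Diff_singleton
          of_nat_diff[of "Suc 0" "CARD('n)", OF Suc_leI[OF zero_less_card_finite]])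
    also have "(real CARD('n) - 1) * \<rho> + sum \<sigma> T = 1 / r - \<rho>"
      using total by (simp add: sum_T algebra_simps)
    also have "\<dots> = 1"
      using r by (simp add: \<rho>_def field_simps)
    finally show ?thesis .
  qed
  have "J \<noteq> {}"
    using p_total r by auto
  have "weighted_volume B \<Omega> \<le> epowr (ennreal K * weighted_perimeter A \<Omega>) (1 / r)"
    if \<Omega>: "open \<Omega>" and fin: "weighted_volume B \<Omega> < \<infinity>" for \<Omega> :: "(real ^ 'n) set"
  proof -
    let ?P = "weighted_perimeter A \<Omega>"
    define h where "h k x = ennreal (g x / \<bar>x $ k\<bar>) * indicator \<Omega> x" for k and x :: "real ^ 'n"
    define f where "f = case_sum (\<lambda>i. fibre_sup i \<Omega> g) (\<lambda>k z. h k (\<chi> i. z i))"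
    have g_cont: "continuous_on UNIV g"
      unfolding g_def by (rule continuous_on_monomial_weight[OF A])
    have [measurable]: "\<Omega> \<in> sets borel" "g \<in> borel_measurable borel"
        "monomial_weight B \<in> borel_measurable borel"
      using \<Omega> A B by (auto simp: g_def intro: borel_measurable_monomial_weight)
    have h_meas [measurable]: "h k \<in> borel_measurable borel" for k
      unfolding h_def by measurable
    have f_meas: "f j \<in> borel_measurable (PiM (D j) (\<lambda>_. lborel))" for j
      using borel_measurable_fibre_sup[OF \<Omega>, of g]
      by (cases j) (auto simp: f_def D_def intro!: measurable_compose[OF measurable_vec_lambda_PiM h_meas])
    have sup_le: "(\<integral>\<^sup>+z. fibre_sup i \<Omega> g z \<partial>lborel_off i) \<le> ennreal \<kappa> * ?P" for i
      unfolding \<kappa>_def weighted_perimeter_def g_def[symmetric]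
    proof (rule nn_integral_fibre_sup_le[OF \<Omega> g_cont _ AE_fibre_exits[OF \<Omega> B fin]])
      show "g (fibre_point i z y) \<le> g (fibre_point i z y')" if "\<bar>y\<bar> \<le> \<bar>y'\<bar>" for z y y'
        using that A by (auto simp: g_def monomial_weight_fibre_point prod_nonneg
            intro!: mult_left_mono coord_weight_mono)
    qed
    have integral_le: "(\<integral>\<^sup>+z. f j z \<partial>PiM (D j) (\<lambda>_. lborel)) \<le> ennreal K * ?P" if "j \<in> J" for j
    proof (cases j)
      case (Inl i)
      have "ennreal \<kappa> * ?P \<le> ennreal K * ?P"
        using K by (intro mult_right_mono ennreal_leI) auto
      then show ?thesis
        using sup_le[of i] by (simp add: Inl f_def D_def)
    next
      case (Inr k)
      then have "0 < \<sigma> k"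
        using that by (auto simp: J_def T_def)
      moreover have "\<sigma> k \<le> A $ k / r"
        using B r by (simp add: \<sigma>_def divide_right_mono)
      ultimately have Ak: "0 < A $ k"
        using r by (auto simp: zero_less_divide_iff dest: less_le_trans)
      have "(\<integral>\<^sup>+z. f j z \<partial>PiM (D j) (\<lambda>_. lborel)) = (\<integral>\<^sup>+x. h k x \<partial>lborel)"
        by (simp add: Inr f_def D_def nn_integral_lborel_vec)
      also have "\<dots> = (\<integral>\<^sup>+z. \<integral>\<^sup>+y. h k (fibre_point k z y) \<partial>lborel \<partial>lborel_off k)"
        by (rule nn_integral_lborel_fibres) measurable
      also have "\<dots> \<le> (\<integral>\<^sup>+z. ennreal (2 / A $ k) * fibre_sup k \<Omega> g z \<partial>lborel_off k)"
        using nn_integral_fibre_Hardy[OF \<Omega> A Ak]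
        by (intro nn_integral_mono) (simp add: h_def g_def fibre_point_nth)
      also have "\<dots> = ennreal (2 / A $ k) * (\<integral>\<^sup>+z. fibre_sup k \<Omega> g z \<partial>lborel_off k)"
        by (intro nn_integral_cmult borel_measurable_fibre_sup \<Omega>) measurable
      also have "\<dots> \<le> ennreal (2 / A $ k) * (ennreal \<kappa> * ?P)"
        by (intro mult_left_mono sup_le) auto
      also have "\<dots> = ennreal (2 / A $ k * \<kappa>) * ?P"
        using Ak \<kappa> by (subst ennreal_mult) (auto simp: mult.assoc)
      also have "\<dots> \<le> ennreal K * ?P"
        by (intro mult_right_mono ennreal_leI K_Hardy) auto
      finally show ?thesis .
    qed
    have pointwise: "ennreal (monomial_weight B (\<chi> i. z i)) * indicator \<Omega> (\<chi> i. z i)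
        \<le> (\<Prod>j\<in>J. epowr (f j (restrict z (D j))) (p j))" if z: "\<And>i. z i \<noteq> 0" for z
    proof (cases "(\<chi> i. z i) \<in> \<Omega>")
      case True
      define x where "x = (\<chi> i. z i)"
      have x: "x \<in> \<Omega>" "x $ k \<noteq> 0" for k
        using True z by (auto simp: x_def)
      have fL: "ennreal (g x powr \<rho>) \<le> epowr (f (Inl i) (restrict z (D (Inl i)))) (p (Inl i))" for i
      proof -
        have "restrict z (- {i}) = proj_off i x"
          by (auto simp: proj_off_def x_def restrict_def)
        then have "ennreal (g x) \<le> f (Inl i) (restrict z (D (Inl i)))"
          using fibre_sup_upper[OF \<Omega> g_cont x(1)] by (simp add: f_def D_def)
        then have "epowr (ennreal (g x)) \<rho> \<le> epowr (f (Inl i) (restrict z (D (Inl i)))) \<rho>"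
          by (rule epowr_mono[OF _ \<rho>])
        then show ?thesis
          by (simp add: epowr_ennreal g_def p_def)
      qed
      have fR: "epowr (f (Inr k) (restrict z (D (Inr k)))) (p (Inr k)) = ennreal ((g x / \<bar>x $ k\<bar>) powr \<sigma> k)" for k
      proof -
        have "f (Inr k) (restrict z (D (Inr k))) = h k x"
          by (simp add: f_def D_def x_def restrict_def)
        then show ?thesis
          using x by (simp add: h_def p_def epowr_ennreal g_def)
      qed
      have g_pos: "0 < g x"
        using x by (auto simp: g_def monomial_weight_eq intro!: prod_pos coord_weight_pos)
      have "monomial_weight B x = g x powr (\<rho> * real CARD('n)) * (\<Prod>k\<in>UNIV. (g x / \<bar>x $ k\<bar>) powr \<sigma> k)"
        unfolding g_def \<rho>_def \<sigma>_def by (rule monomial_weight_factorization[OF r(1) scal x(2)])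
      also have "g x powr (\<rho> * real CARD('n)) = (\<Prod>i\<in>L. g x powr \<rho>)"
        using \<rho> g_pos by (auto simp: L_def le_less powr_powr[symmetric] powr_realpow)
      also have "(\<Prod>k\<in>UNIV. (g x / \<bar>x $ k\<bar>) powr \<sigma> k) = (\<Prod>k\<in>T. (g x / \<bar>x $ k\<bar>) powr \<sigma> k)"
      proof (intro prod.mono_neutral_right ballI)
        fix k
        assume "k \<in> UNIV - T"
        then have "\<sigma> k = 0"
          using \<sigma>[of k] by (simp add: T_def)
        then show "(g x / \<bar>x $ k\<bar>) powr \<sigma> k = 1"
          using g_pos x(2)[of k] by simp
      qed auto
      finally have "ennreal (monomial_weight B x)
          = (\<Prod>i\<in>L. ennreal (g x powr \<rho>)) * (\<Prod>k\<in>T. ennreal ((g x / \<bar>x $ k\<bar>) powr \<sigma> k))"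
        by (simp add: ennreal_mult prod_nonneg prod_ennreal del: prod_constant)
      also have "\<dots> \<le> (\<Prod>j\<in>J. epowr (f j (restrict z (D j))) (p j))"
        unfolding prod_J fR by (intro mult_right_mono prod_mono_ennreal fL) auto
      finally show ?thesis
        using x(1) by (simp add: x_def)
    qed simp
    have "weighted_volume B \<Omega> = (\<integral>\<^sup>+z. ennreal (monomial_weight B (\<chi> i. z i)) * indicator \<Omega> (\<chi> i. z i)
        \<partial>PiM UNIV (\<lambda>_. lborel))"
      unfolding weighted_volume_def by (rule nn_integral_lborel_vec) measurable
    also have "\<dots> \<le> (\<integral>\<^sup>+z. (\<Prod>j\<in>J. epowr (f j (restrict z (D j))) (p j)) \<partial>PiM UNIV (\<lambda>_. lborel))"
    proof (rule nn_integral_mono_AE)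
      have "AE z in PiM UNIV (\<lambda>_::'n. lborel :: real measure). \<forall>i\<in>UNIV. z i \<noteq> 0"
        by (rule AE_PiM_lborel_nonzero) simp
      then show "AE z in PiM UNIV (\<lambda>_. lborel).
          ennreal (monomial_weight B (\<chi> i. z i)) * indicator \<Omega> (\<chi> i. z i)
          \<le> (\<Prod>j\<in>J. epowr (f j (restrict z (D j))) (p j))"
        by eventually_elim (rule pointwise, simp)
    qed
    also have "\<dots> \<le> (\<Prod>j\<in>J. epowr (\<integral>\<^sup>+z. f j z \<partial>PiM (D j) (\<lambda>_. lborel)) (p j))"
      using p_coord by (intro lborel_PiM.Finner_inequality J p f_meas) auto
    also have "\<dots> \<le> (\<Prod>j\<in>J. epowr (ennreal K * ?P) (p j))"
      using p by (intro prod_mono_ennreal epowr_mono integral_le) (auto intro: less_imp_le)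
    also have "\<dots> = epowr (ennreal K * ?P) (1 / r)"
      unfolding p_total[symmetric] by (rule prod_epowr[OF J \<open>J \<noteq> {}\<close>])
    finally show ?thesis .
  qed
  with K(1) show ?thesis
    by (rule that)
qed

lemma iso_constant_pos:
  fixes A B :: "real ^ 'n"
  assumes A: "\<And>i. 0 \<le> A $ i" and B: "\<And>i. 0 \<le> B $ i"
    and r: "0 < iso_exponent A B" "iso_exponent A B \<le> 1"
    and \<tau>: "\<And>i. 0 \<le> A $ i - iso_exponent A B * B $ i"
  shows "0 < iso_constant A B"
proof -
  define r where "r = iso_exponent A B"
  have "0 < real CARD('n) + (\<Sum>i\<in>UNIV. B $ i)"
    using B by (intro add_pos_nonneg sum_nonneg) auto
  then have "r * (real CARD('n) + (\<Sum>i\<in>UNIV. B $ i)) = real CARD('n) + (\<Sum>i\<in>UNIV. A $ i) - 1"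
    by (simp add: r_def iso_exponent_def)
  then obtain K where K: "0 < K" and
    le: "\<And>\<Omega>. open \<Omega> \<Longrightarrow> weighted_volume B \<Omega> < \<infinity> \<Longrightarrow>
      weighted_volume B \<Omega> \<le> epowr (ennreal K * weighted_perimeter A \<Omega>) (1 / r)"
    using weighted_volume_le_perimeter_powr[of A B r] A B \<open>0 < iso_exponent A B\<close> r(2) \<tau>
    unfolding r_def[symmetric] by blast
  have "0 < ennreal (1 / K)"
    using K by simp
  also have "ennreal (1 / K) \<le> iso_constant A B"
    unfolding iso_constant_def
  proof (rule INF_greatest, safe)
    fix \<Omega> :: "(real ^ 'n) set"
    assume \<Omega>: "smooth_open_set \<Omega>" and V: "0 < weighted_volume B \<Omega>" "weighted_volume B \<Omega> < \<infinity>"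
    obtain v where v: "weighted_volume B \<Omega> = ennreal v" "0 < v"
      using V by (cases "weighted_volume B \<Omega>") auto
    have "epowr (weighted_volume B \<Omega>) r \<le> epowr (epowr (ennreal K * weighted_perimeter A \<Omega>) (1 / r)) r"
      using \<Omega> V r(1) by (intro epowr_mono le) (auto simp: smooth_open_set_def r_def)
    also have "\<dots> = ennreal K * weighted_perimeter A \<Omega>"
      using r(1) by (simp add: epowr_epowr r_def[symmetric])
    finally have "ennreal (v powr r) \<le> ennreal K * weighted_perimeter A \<Omega>"
      using v by (simp add: epowr_ennreal)
    then have "ennreal (v powr r) / ennreal K \<le> weighted_perimeter A \<Omega>"
      using K by (intro divide_le_posI_ennreal) auto
    then have "ennreal (v powr r) / ennreal K / ennreal (v powr r) \<le> weighted_perimeter A \<Omega> / ennreal (v powr r)"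
      by (rule divide_right_mono_ennreal)
    then show "ennreal (1 / K) \<le> weighted_perimeter A \<Omega> /
        ennreal (enn2real (weighted_volume B \<Omega>) powr iso_exponent A B)"
      using K v by (simp add: divide_ennreal r_def[symmetric])
  qed
  finally show ?thesis .
qed

section \<open>The sphere has finite Hausdorff measure\<close>

lemma hausdorff_premeasure_finite_UN_le:
  assumes "finite I" "0 \<le> \<delta>"
  shows "hausdorff_premeasure d \<delta> (\<Union>c\<in>I. C c) \<le> (\<Sum>c\<in>I. hausdorff_premeasure d \<delta> (C c))"
  using assms(1)
proof induction
  case (insert c I)
  then show ?case
    using hausdorff_premeasure_Un_le[OF assms(2), of d "C c" "\<Union>c\<in>I. C c"]
    by (simp add: order_trans[OF _ add_left_mono])
qed (simp add: hausdorff_premeasure_empty assms)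

lemma hausdorff_outer_finite_UN_le:
  assumes "finite I"
  shows "hausdorff_outer d (\<Union>c\<in>I. C c) \<le> (\<Sum>c\<in>I. hausdorff_outer d (C c))"
  using assms
proof induction
  case (insert c I)
  then show ?case
    using hausdorff_outer_Un_le[of d "C c" "\<Union>c\<in>I. C c"]
    by (simp add: order_trans[OF _ add_left_mono])
qed simp

lemma hausdorff_premeasure_le_gauge:
  assumes "bounded C" "diameter C \<le> \<delta>" "0 \<le> \<delta>"
  shows "hausdorff_premeasure d \<delta> C \<le> hausdorff_gauge d C"
proof -
  have "hausdorff_premeasure d \<delta> C \<le> (\<Sum>n::nat. hausdorff_gauge d (if n = 0 then C else {}))"
    by (rule hausdorff_premeasure_le_cover) (use assms in auto)
  also have "\<dots> = (\<Sum>n\<in>{0::nat}. hausdorff_gauge d (if n = 0 then C else {}))"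
    by (rule suminf_finite) auto
  finally show ?thesis
    by simp
qed

lemma hausdorff_outer_Lipschitz_image_le:
  fixes f :: "'a::metric_space \<Rightarrow> 'b::real_normed_vector"
  assumes f: "\<And>x y. dist (f x) (f y) \<le> dist x y"
  shows "hausdorff_outer d (f ` E) \<le> hausdorff_outer d E"
proof -
  have image: "bounded (f ` C)" "diameter (f ` C) \<le> diameter C" if C: "bounded C" for C
  proof -
    obtain x e where "\<forall>y\<in>C. dist x y \<le> e"
      using C unfolding bounded_def by blast
    then have "\<forall>y\<in>f ` C. dist (f x) y \<le> e"
      using f order_trans by blast
    then show "bounded (f ` C)"
      unfolding bounded_def by blast
    show "diameter (f ` C) \<le> diameter C"
    proof (rule diameter_le)
      show "f ` C \<noteq> {} \<or> 0 \<le> diameter C"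
        using C by (simp add: diameter_ge_0)
    next
      fix u v
      assume "u \<in> f ` C" "v \<in> f ` C"
      then obtain x y where "x \<in> C" "y \<in> C" "u = f x" "v = f y"
        by blast
      then show "norm (u - v) \<le> diameter C"
        using f[of x y] diameter_bounded_bound[OF C, of x y] by (simp add: dist_norm)
    qed
  qed
  have gauge: "hausdorff_gauge d (f ` C) \<le> hausdorff_gauge d C" if C: "bounded C" for C
    using image[OF C] diameter_ge_0[OF image(1)[OF C]]
    by (auto simp: hausdorff_gauge_def intro!: ennreal_leI mult_left_mono power_mono)
  have "hausdorff_premeasure d \<delta> (f ` E) \<le> hausdorff_premeasure d \<delta> E" for \<delta>
    unfolding hausdorff_premeasure_def[of d \<delta> E]
  proof (rule INF_greatest, safe)
    fix C :: "nat \<Rightarrow> 'a set"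
    assume C: "\<forall>n. bounded (C n) \<and> diameter (C n) \<le> \<delta>" "E \<subseteq> (\<Union>n. C n)"
    have "hausdorff_premeasure d \<delta> (f ` E) \<le> (\<Sum>n. hausdorff_gauge d (f ` C n))"
    proof (rule hausdorff_premeasure_le_cover)
      show "bounded (f ` C n)" "diameter (f ` C n) \<le> \<delta>" for n
        using C(1) image[of "C n"] order_trans by blast+
      show "f ` E \<subseteq> (\<Union>n. f ` C n)"
        using C(2) by blast
    qed
    also have "\<dots> \<le> (\<Sum>n. hausdorff_gauge d (C n))"
      using C gauge by (intro suminf_le) auto
    finally show "hausdorff_premeasure d \<delta> (f ` E) \<le> (\<Sum>n. hausdorff_gauge d (C n))" .
  qed
  then show ?thesis
    unfolding hausdorff_outer_def by (intro SUP_mono) auto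
qed

lemma ex_grid_interval:
  fixes t :: real
  assumes "\<bar>t\<bar> \<le> 1" "0 < m"
  shows "\<exists>k<m. -1 + 2 * real k / real m \<le> t \<and> t \<le> -1 + 2 * real (k + 1) / real m"
proof -
  define u where "u = (t + 1) / 2 * real m"
  have u: "0 \<le> u" "u \<le> real m"
    using assms mult_right_mono[of "(t + 1) / 2" 1 "real m"] by (auto simp: u_def)
  have "\<exists>k<m. real k \<le> u \<and> u \<le> real (k + 1)"
  proof (cases "u = real m")
    case True
    then show ?thesis
      using assms(2) by (intro exI[of _ "m - 1"]) auto
  next
    case False
    then show ?thesis
      using u by (intro exI[of _ "nat \<lfloor>u\<rfloor>"]) (auto, linarith+)
  qed
  then show ?thesis
    using assms(2) by (auto simp: u_def field_simps)
qed

text \<open>A face of the cube splits into \<open>m\<^sup>d\<close> cells of diameter at most \<open>2N/m\<close>, whose gauges add up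
  to a bound that does not depend on m.\<close>

lemma hausdorff_outer_cube_face_finite:
  fixes s :: real and i :: "'n::finite"
  defines "d \<equiv> CARD('n) - 1"
  shows "hausdorff_outer d {x :: real ^ 'n. x $ i = s \<and> (\<forall>j. \<bar>x $ j\<bar> \<le> 1)} < \<infinity>"
proof -
  let ?F = "{x :: real ^ 'n. x $ i = s \<and> (\<forall>j. \<bar>x $ j\<bar> \<le> 1)}"
  let ?N = "real CARD('n)"
  define M where "M = unit_ball_vol d * ?N ^ d"
  have bound: "hausdorff_premeasure d \<delta> ?F \<le> ennreal M" if "0 < \<delta>" for \<delta>
  proof -
    obtain m :: nat where m: "2 * ?N / \<delta> < real m"
      using reals_Archimedean2 by blast
    have m0: "0 < m"
      using m that by (auto intro!: gr0I simp: divide_less_0_iff)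
    have m\<delta>: "2 * ?N / real m \<le> \<delta>"
      using m m0 that by (simp add: field_simps)
    define I where "I = (\<Pi>\<^sub>E j\<in>- {i}. {..<m})"
    define C where "C k = {x \<in> ?F. \<forall>j\<in>- {i}. -1 + 2 * real (k j) / real m \<le> x $ j
        \<and> x $ j \<le> -1 + 2 * real (k j + 1) / real m}" for k :: "'n \<Rightarrow> nat"
    have I: "finite I" "card I = m ^ d"
      by (auto simp: I_def card_PiE d_def Compl_eq_Diff_UNIV card_Diff_singleton intro!: finite_PiE)
    have "?F \<subseteq> (\<Union>k\<in>I. C k)"
    proof
      fix x
      assume x: "x \<in> ?F"
      then have "\<forall>j. \<exists>k<m. -1 + 2 * real k / real m \<le> x $ j \<and> x $ j \<le> -1 + 2 * real (k + 1) / real m"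
        using ex_grid_interval[OF _ m0] by auto
      then obtain k where k: "\<And>j. k j < m" "\<And>j. -1 + 2 * real (k j) / real m \<le> x $ j"
          "\<And>j. x $ j \<le> -1 + 2 * real (k j + 1) / real m"
        by metis
      then show "x \<in> (\<Union>k\<in>I. C k)"
        using x by (intro UN_I[of "restrict k (- {i})"]) (auto simp: I_def C_def)
    qed
    then have "hausdorff_premeasure d \<delta> ?F \<le> hausdorff_premeasure d \<delta> (\<Union>k\<in>I. C k)"
      by (rule hausdorff_premeasure_mono)
    also have "\<dots> \<le> (\<Sum>k\<in>I. hausdorff_premeasure d \<delta> (C k))"
      using I that by (intro hausdorff_premeasure_finite_UN_le) auto
    also have "\<dots> \<le> (\<Sum>k\<in>I. ennreal (unit_ball_vol d * (?N / real m) ^ d))"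
    proof (rule sum_mono)
      fix k
      have close: "norm (x - y) \<le> 2 * ?N / real m" if "x \<in> C k" "y \<in> C k" for x y
      proof -
        have "\<bar>(x - y) $ j\<bar> \<le> 2 / real m" for j
        proof (cases "j = i")
          case True
          then show ?thesis
            using that by (simp add: C_def)
        next
          case False
          then have "-1 + 2 * real (k j) / real m \<le> x $ j" "x $ j \<le> -1 + 2 * real (k j + 1) / real m"
            "-1 + 2 * real (k j) / real m \<le> y $ j" "y $ j \<le> -1 + 2 * real (k j + 1) / real m"
            using that by (auto simp: C_def)
          moreover have "2 * real (k j + 1) / real m = 2 * real (k j) / real m + 2 / real m"
            by (simp add: add_divide_distrib algebra_simps)
          ultimately show ?thesis
            by (simp only: vector_minus_component)
        qed
        then have "(\<Sum>j\<in>UNIV. \<bar>(x - y) $ j\<bar>) \<le> (\<Sum>j\<in>(UNIV :: 'n set). 2 / real m)"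
          by (intro sum_mono)
        then show ?thesis
          using norm_le_l1_cart[of "x - y"] by (simp add: mult.commute)
      qed
      then have diam: "diameter (C k) \<le> 2 * ?N / real m"
        by (intro diameter_le) auto
      have bdd: "bounded (C k)"
      proof (cases "C k = {}")
        case False
        then obtain x where "x \<in> C k"
          by blast
        then show ?thesis
          unfolding bounded_def using close by (intro exI[of _ x] exI[of _ "2 * ?N / real m"]) (auto simp: dist_norm)
      qed simp
      have "hausdorff_premeasure d \<delta> (C k) \<le> hausdorff_gauge d (C k)"
        using diam m\<delta> that bdd by (intro hausdorff_premeasure_le_gauge) auto
      also have "\<dots> \<le> ennreal (unit_ball_vol d * (?N / real m) ^ d)"
        using diam diameter_ge_0[OF bdd]
        by (auto simp: hausdorff_gauge_def intro!: ennreal_leI mult_left_mono power_mono)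
      finally show "hausdorff_premeasure d \<delta> (C k) \<le> ennreal (unit_ball_vol d * (?N / real m) ^ d)" .
    qed
    also have "\<dots> = ennreal (real (m ^ d) * (unit_ball_vol d * (?N / real m) ^ d))"
      by (simp only: sum_constant I(2)) (subst ennreal_mult, auto simp: ennreal_of_nat_eq_real_of_nat)
    also have "real (m ^ d) * (unit_ball_vol d * (?N / real m) ^ d) = M"
      using m0 by (simp add: M_def power_divide)
    finally show ?thesis .
  qed
  have "hausdorff_outer d ?F \<le> ennreal M"
    unfolding hausdorff_outer_def by (intro SUP_least bound) simp
  then show ?thesis
    by (rule le_less_trans) simp
qed

text \<open>The nearest-point projection to the unit ball is 1-Lipschitz and maps the boundary of the
  cube onto the sphere.\<close>

lemma hausdorff_outer_sphere_finite:
  "hausdorff_outer (CARD('n) - 1) (sphere 0 1 :: (real ^ 'n) set) < \<infinity>"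
proof -
  let ?d = "CARD('n) - 1"
  let ?F = "\<lambda>(i, s). {x :: real ^ 'n. x $ i = s \<and> (\<forall>j. \<bar>x $ j\<bar> \<le> 1)}"
  let ?I = "(UNIV :: 'n set) \<times> {-1, 1 :: real}"
  let ?\<pi> = "closest_point (cball 0 1 :: (real ^ 'n) set)"
  have "sphere 0 1 \<subseteq> ?\<pi> ` (\<Union>c\<in>?I. ?F c)"
  proof
    fix x :: "real ^ 'n"
    assume "x \<in> sphere 0 1"
    then have x: "norm x = 1"
      by simp
    obtain i where i: "\<And>j. \<bar>x $ j\<bar> \<le> \<bar>x $ i\<bar>"
      using Max_in[of "range (\<lambda>j. \<bar>x $ j\<bar>)"] Max_ge[of "range (\<lambda>j. \<bar>x $ j\<bar>)"] by fastforce
    define c where "c = \<bar>x $ i\<bar>"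
    have c: "0 < c" "c \<le> 1"
    proof -
      have "c \<noteq> 0"
      proof
        assume "c = 0"
        then have "x = 0"
          using i by (simp add: c_def vec_eq_iff)
        with x show False
          by simp
      qed
      then show "0 < c"
        by (simp add: c_def)
      show "c \<le> 1"
        using component_le_norm_cart[of x i] x by (simp add: c_def)
    qed
    define y where "y = (1 / c) *\<^sub>R x"
    have "x = ?\<pi> y"
    proof (rule closest_point_unique)
      show "\<forall>z\<in>cball 0 1. dist y x \<le> dist y z"
      proof
        fix z :: "real ^ 'n"
        assume "z \<in> cball 0 1"
        have "norm (y - x) = norm ((1 / c - 1) *\<^sub>R x)"
          by (simp add: y_def algebra_simps)
        then have "dist y x = 1 / c - 1"
          using x c by (simp add: dist_norm)
        also have "1 / c = norm y"
          using x c by (simp add: y_def)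
        also have "norm y - 1 \<le> dist y z"
          using \<open>z \<in> cball 0 1\<close> norm_triangle_ineq2[of y z] by (simp add: dist_norm)
        finally show "dist y x \<le> dist y z" .
      qed
    qed (use x in auto)
    moreover have "y \<in> (\<Union>c\<in>?I. ?F c)"
    proof
      show "(i, sgn (x $ i)) \<in> ?I"
        using c by (auto simp: c_def sgn_if)
      show "y \<in> ?F (i, sgn (x $ i))"
        using c i by (auto simp: y_def c_def sgn_if abs_mult field_simps)
    qed
    ultimately show "x \<in> ?\<pi> ` (\<Union>c\<in>?I. ?F c)"
      by blast
  qed
  then have "hausdorff_outer ?d (sphere 0 1 :: (real ^ 'n) set) \<le> hausdorff_outer ?d (?\<pi> ` (\<Union>c\<in>?I. ?F c))"
    by (rule hausdorff_outer_mono)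
  also have "\<dots> \<le> hausdorff_outer ?d (\<Union>c\<in>?I. ?F c)"
    by (intro hausdorff_outer_Lipschitz_image_le closest_point_lipschitz) auto
  also have "\<dots> \<le> (\<Sum>c\<in>?I. hausdorff_outer ?d (?F c))"
    by (rule hausdorff_outer_finite_UN_le) simp
  also have "\<dots> < \<infinity>"
    using hausdorff_outer_cube_face_finite by (auto simp: less_top[symmetric] split_def)
  finally show ?thesis .
qed

section \<open>Ellipsoids are smooth open sets\<close>

lemma Ck_on_const: "Ck_on k (\<lambda>x. c) U"
  by (induction k arbitrary: c) auto

lemma Ck_on_affine:
  assumes "bounded_linear l"
  shows "Ck_on k (\<lambda>x. l x + c) U"
proof (cases k)
  case 0
  then show ?thesis
    using linear_continuous_on[OF assms, of U] by (simp add: continuous_on_add)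
next
  case (Suc m)
  have der: "((\<lambda>x. l x + c) has_derivative l) (at x)" for x
    using assms by (auto intro!: derivative_eq_intros bounded_linear.has_derivative[OF assms])
  then have "frechet_derivative (\<lambda>x. l x + c) (at x) = l" for x
    by (metis frechet_derivative_at)
  then show ?thesis
    using der by (auto simp: Suc Ck_on_const differentiable_def)
qed

text \<open>The defining function is quadratic, so its first derivatives are affine and all further ones
  are constant. Its derivative at x vanishes only if T maps x - c to 0, which does not happen on the
  boundary.\<close>

lemma smooth_open_set_ellipsoid:
  fixes T :: "'a::euclidean_space \<Rightarrow> 'b::euclidean_space"
  assumes T: "bounded_linear T"
  shows "smooth_open_set {x. norm (T (x - c)) < 1}"
    and "frontier {x. norm (T (x - c)) < 1} \<subseteq> {x. norm (T (x - c)) = 1}"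
proof -
  let ?\<Omega> = "{x. norm (T (x - c)) < 1}"
  have T_cont: "continuous_on UNIV (\<lambda>x. T (x - c))"
    by (intro bounded_linear.continuous_on[OF T] continuous_intros)
  have "open ?\<Omega>"
    by (intro open_Collect_less continuous_intros T_cont)
  have "closed {x. norm (T (x - c)) \<le> 1}"
    by (intro closed_Collect_le continuous_intros T_cont)
  then have "closure ?\<Omega> \<subseteq> {x. norm (T (x - c)) \<le> 1}"
    by (intro closure_minimal) auto
  with \<open>open ?\<Omega>\<close> show frontier: "frontier ?\<Omega> \<subseteq> {x. norm (T (x - c)) = 1}"
    by (force simp: frontier_def interior_open)
  define \<phi> where "\<phi> x = T (x - c) \<bullet> T (x - c) - 1" for x
  have T_der: "((\<lambda>x. T (x - c)) has_derivative T) (at x)" for x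
  proof -
    have "((\<lambda>x. x - c) has_derivative (\<lambda>v. v)) (at x)"
      by (auto intro!: derivative_eq_intros)
    from bounded_linear.has_derivative[OF T this] show ?thesis .
  qed
  have \<phi>_der: "(\<phi> has_derivative (\<lambda>v. 2 * (T (x - c) \<bullet> T v))) (at x)" for x
  proof -
    have "((\<lambda>x. T (x - c) \<bullet> T (x - c)) has_derivative (\<lambda>v. T (x - c) \<bullet> T v + T v \<bullet> T (x - c))) (at x)"
      by (rule has_derivative_inner[OF T_der T_der])
    from has_derivative_diff[OF this has_derivative_const[of 1]] show ?thesis
      by (simp add: \<phi>_def[abs_def] inner_commute)
  qed
  have fd: "frechet_derivative \<phi> (at x) = (\<lambda>v. 2 * (T (x - c) \<bullet> T v))" for x
    using \<phi>_der by (metis frechet_derivative_at)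
  have smooth: "smooth_on \<phi> U" for U
    unfolding smooth_on_def
  proof
    fix k
    show "Ck_on k \<phi> U"
    proof (cases k)
      case 0
      have "continuous_on U \<phi>"
        unfolding \<phi>_def by (intro continuous_intros continuous_on_subset[OF T_cont]) auto
      then show ?thesis
        by (simp add: 0)
    next
      case (Suc m)
      have "(\<lambda>x. frechet_derivative \<phi> (at x) e) = (\<lambda>x. 2 * (T x \<bullet> T e) + - 2 * (T c \<bullet> T e))" for e
        using T by (simp add: fd fun_eq_iff linear_diff bounded_linear.linear inner_diff_left algebra_simps)
      moreover have "bounded_linear (\<lambda>x. 2 * (T x \<bullet> T e))" for e
        by (intro bounded_linear_const_mult bounded_linear_inner_left_comp T)
      ultimately have "Ck_on m (\<lambda>x. frechet_derivative \<phi> (at x) e) U" for e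
        using Ck_on_affine by metis
      then show ?thesis
        using \<phi>_der by (auto simp: Suc differentiable_def)
    qed
  qed
  show "smooth_open_set ?\<Omega>"
    unfolding smooth_open_set_def
  proof (intro conjI ballI \<open>open ?\<Omega>\<close>)
    fix p
    assume "p \<in> frontier ?\<Omega>"
    then have p: "norm (T (p - c)) = 1"
      using frontier by auto
    let ?U = "{x. T (x - c) \<noteq> 0}"
    have "open ?U"
      by (intro open_Collect_neq T_cont continuous_intros)
    moreover have "p \<in> ?U"
      using p by auto
    moreover have "\<forall>x\<in>?U. frechet_derivative \<phi> (at x) \<noteq> (\<lambda>v. 0)"
    proof
      fix x
      assume "x \<in> ?U"
      then have "frechet_derivative \<phi> (at x) (x - c) \<noteq> 0"
        by (simp add: fd)
      then show "frechet_derivative \<phi> (at x) \<noteq> (\<lambda>v. 0)"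
        by metis
    qed
    moreover have "?\<Omega> \<inter> ?U = {x \<in> ?U. \<phi> x < 0}"
      by (auto simp: \<phi>_def norm_lt_square dot_square_norm power2_eq_square abs_square_less_1)
    ultimately show "\<exists>U \<phi>. open U \<and> p \<in> U \<and> smooth_on \<phi> U
        \<and> (\<forall>x\<in>U. frechet_derivative \<phi> (at x) \<noteq> (\<lambda>v. 0)) \<and> ?\<Omega> \<inter> U = {x \<in> U. \<phi> x < 0}"
      using smooth by blast
  qed
qed

section \<open>Ellipsoids as test sets\<close>

lemma monomial_weight_scaled:
  fixes A :: "real ^ 'n"
  assumes "0 < \<eta>" "0 < s"
  shows "monomial_weight A (\<chi> j. \<eta> * (if j = i then s else 1))
    = \<eta> powr (\<Sum>j\<in>UNIV. A $ j) * s powr (A $ i)"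
proof -
  have "monomial_weight A (\<chi> j. \<eta> * (if j = i then s else 1))
      = (\<Prod>j\<in>UNIV. \<eta> powr (A $ j) * (if j = i then s powr (A $ i) else 1))"
    unfolding monomial_weight_eq using assms
    by (intro prod.cong refl) (auto simp: coord_weight_eq_powr powr_mult abs_mult)
  also have "\<dots> = \<eta> powr (\<Sum>j\<in>UNIV. A $ j) * s powr (A $ i)"
    using assms by (simp add: prod.distrib powr_sum)
  finally show ?thesis .
qed

lemma monomial_weight_mono:
  assumes "\<And>j. 0 \<le> A $ j" "\<And>j. \<bar>x $ j\<bar> \<le> \<bar>y $ j\<bar>"
  shows "monomial_weight A x \<le> monomial_weight A y"
  unfolding monomial_weight_eq by (intro prod_mono conjI coord_weight_nonneg coord_weight_mono assms)

text \<open>The test set is the ellipsoid with centre t on the i-th axis and semiaxis \<open>\<epsilon>\<close> in this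
  direction, all others being 1. Up to constants its weighted perimeter is at most
  \<open>(t + \<epsilon>)\<close> to the power \<open>a\<^sub>i\<close>, the ellipsoid being a contraction of the unit ball, and its
  weighted volume is at least \<open>\<epsilon>\<close> times \<open>(t + \<epsilon>)\<close> to the power \<open>b\<^sub>i\<close>, already on a box away from
  the coordinate hyperplanes.\<close>

lemma iso_constant_le_ellipsoid:
  fixes A B :: "real ^ 'n" and i :: 'n
  assumes A: "\<And>j. 0 \<le> A $ j" and B: "\<And>j. 0 \<le> B $ j"
    and r: "0 \<le> iso_exponent A B"
  obtains M where "\<And>t \<epsilon>. 0 \<le> t \<Longrightarrow> 0 < \<epsilon> \<Longrightarrow> \<epsilon> \<le> 1 \<Longrightarrow>
    iso_constant A B \<le> ennreal (M * (t + \<epsilon>) powr (A $ i - iso_exponent A B * B $ i)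
      * \<epsilon> powr (- iso_exponent A B))"
proof -
  let ?d = "CARD('n) - 1"
  define r where "r = iso_exponent A B"
  obtain m0 where m0: "0 \<le> m0" "hausdorff_outer ?d (sphere 0 1 :: (real ^ 'n) set) = ennreal m0"
    using hausdorff_outer_sphere_finite[where 'n = 'n]
    by (cases "hausdorff_outer ?d (sphere 0 1 :: (real ^ 'n) set)") auto
  \<comment> \<open>The cube with sides from \<open>\<eta>\<close> to \<open>2\<eta>\<close> lies in the unit ball, since its points have
    1-norm at most 1/2.\<close>
  define \<eta> where "\<eta> = 1 / (4 * real CARD('n))"
  have \<eta>: "0 < \<eta>" "\<eta> \<le> 1"
  proof -
    show "0 < \<eta>"
      by (simp add: \<eta>_def)
    have "1 \<le> real CARD('n)"
      using zero_less_card_finite[where 'a = 'n] by linarith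
    then show "\<eta> \<le> 1"
      unfolding \<eta>_def by (subst divide_le_eq_1) linarith
  qed
  define q where "q = \<eta> powr (\<Sum>j\<in>UNIV. B $ j) * \<eta> ^ CARD('n)"
  have q: "0 < q"
    using \<eta> by (simp add: q_def)
  have "iso_constant A B \<le> ennreal (m0 / q powr r * (t + \<epsilon>) powr (A $ i - r * B $ i) * \<epsilon> powr (- r))"
    if t: "0 \<le> t" and \<epsilon>: "0 < \<epsilon>" "\<epsilon> \<le> 1" for t \<epsilon>
  proof -
    define s where "s = t + \<epsilon>"
    have s: "0 < s"
      using t \<epsilon> by (simp add: s_def)
    define c where "c = (\<chi> j. if j = i then t else 0)"
    define D where "D j = (if j = i then \<epsilon> else 1)" for j
    have D: "0 < D j" "D j \<le> 1" for j
      using \<epsilon> by (auto simp: D_def)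
    define T where "T = (\<lambda>x :: real ^ 'n. \<chi> j. x $ j / D j)"
    have T: "bounded_linear T"
      unfolding linear_conv_bounded_linear[symmetric]
      by (rule linearI) (auto simp: T_def vec_eq_iff add_divide_distrib)
    define \<Omega> where "\<Omega> = {x. norm (T (x - c)) < 1}"
    have smooth: "smooth_open_set \<Omega>" and fr: "frontier \<Omega> \<subseteq> {x. norm (T (x - c)) = 1}"
      unfolding \<Omega>_def by (rule smooth_open_set_ellipsoid[OF T])+
    have \<Omega>_open: "open \<Omega>"
      using smooth by (simp add: smooth_open_set_def)
    define e where "e = (\<chi> j. if j = i then s else 1)"
    have e: "0 < e $ j" for j
      using s by (simp add: e_def)
    have weight_e: "monomial_weight C e = s powr (C $ i)" for C
    proof -
      have "e = (\<chi> j. 1 * (if j = i then s else 1))"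
        by (simp add: e_def)
      then show ?thesis
        using monomial_weight_scaled[of 1 s C i] s by simp
    qed
    have coord: "\<bar>x $ j\<bar> \<le> e $ j" if "norm (T (x - c)) \<le> 1" for x j
    proof -
      have "\<bar>T (x - c) $ j\<bar> \<le> 1"
        using component_le_norm_cart[of "T (x - c)" j] that by linarith
      then have "\<bar>x $ j - c $ j\<bar> \<le> D j"
        using D(1)[of j] by (simp add: T_def abs_divide pos_divide_le_eq)
      then show ?thesis
        using t by (auto simp: c_def D_def e_def s_def abs_le_iff)
    qed
    have upper: "monomial_weight C x \<le> s powr (C $ i)"
      if "norm (T (x - c)) \<le> 1" "\<And>j. 0 \<le> C $ j" for x C
      unfolding weight_e[symmetric]
      using coord[OF that(1)] e by (intro monomial_weight_mono that) (simp add: abs_of_pos)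
    \<comment> \<open>The boundary is the image of the unit sphere under a 1-Lipschitz map.\<close>
    have frontier_le: "hausdorff_outer ?d (frontier \<Omega>) \<le> ennreal m0"
    proof -
      let ?F = "\<lambda>y :: real ^ 'n. c + (\<chi> j. D j * y $ j)"
      have "frontier \<Omega> \<subseteq> ?F ` sphere 0 1"
      proof
        fix x
        assume "x \<in> frontier \<Omega>"
        then have "T (x - c) \<in> sphere 0 1"
          using fr by auto
        moreover have "x = ?F (T (x - c))"
          using D(1) by (simp add: vec_eq_iff T_def less_imp_neq[symmetric])
        ultimately show "x \<in> ?F ` sphere 0 1"
          by blast
      qed
      then have "hausdorff_outer ?d (frontier \<Omega>) \<le> hausdorff_outer ?d (?F ` sphere 0 1)"
        by (rule hausdorff_outer_mono)
      also have "\<dots> \<le> hausdorff_outer ?d (sphere 0 1 :: (real ^ 'n) set)"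
      proof (rule hausdorff_outer_Lipschitz_image_le)
        fix x y :: "real ^ 'n"
        have "?F x - ?F y = (\<chi> j. D j * (x - y) $ j)"
          by (simp add: vec_eq_iff algebra_simps)
        moreover have "norm (\<chi> j. D j * (x - y) $ j) \<le> norm (x - y)"
          using D by (intro norm_le_componentwise_cart)
            (simp add: abs_mult abs_of_pos mult_left_le_one_le less_imp_le)
        ultimately show "dist (?F x) (?F y) \<le> dist x y"
          by (simp only: dist_norm)
      qed
      finally show ?thesis
        by (simp only: m0(2))
    qed
    have P: "weighted_perimeter A \<Omega> \<le> ennreal (s powr (A $ i) * m0)"
    proof -
      have "weighted_perimeter A \<Omega>
          \<le> (\<integral>\<^sup>+x. ennreal (s powr (A $ i)) * indicator (frontier \<Omega>) x \<partial>hausdorff_measure ?d)"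
        unfolding weighted_perimeter_def using fr A
        by (intro nn_integral_mono) (auto simp: indicator_def intro!: ennreal_leI upper)
      also have "\<dots> = ennreal (s powr (A $ i)) * hausdorff_outer ?d (frontier \<Omega>)"
        by (subst nn_integral_cmult_indicator) (auto simp: emeasure_hausdorff_measure borel_closed)
      also have "\<dots> \<le> ennreal (s powr (A $ i)) * ennreal m0"
        by (intro mult_left_mono frontier_le) simp
      finally show ?thesis
        using m0(1) by (simp add: ennreal_mult)
    qed
    have V_fin: "weighted_volume B \<Omega> < \<infinity>"
    proof -
      have "weighted_volume B \<Omega> \<le> (\<integral>\<^sup>+x. ennreal (s powr (B $ i)) * indicator \<Omega> x \<partial>lborel)"
        unfolding weighted_volume_def using B
        by (intro nn_integral_mono) (auto simp: indicator_def \<Omega>_def intro!: ennreal_leI upper)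
      also have "\<dots> = ennreal (s powr (B $ i)) * emeasure lborel \<Omega>"
        using \<Omega>_open by (intro nn_integral_cmult_indicator) simp
      also have "emeasure lborel \<Omega> \<le> emeasure lborel (cbox (- e) e)"
        using coord by (intro emeasure_mono) (auto simp: \<Omega>_def mem_box_cart abs_le_iff minus_le_iff less_imp_le)
      then have "ennreal (s powr (B $ i)) * emeasure lborel \<Omega> < \<infinity>"
        using emeasure_lborel_cbox_finite[of "- e" e]
        by (auto simp: ennreal_mult_less_top intro: le_less_trans)
      finally show ?thesis .
    qed
    \<comment> \<open>The cube is mapped to the box from l to u, which lies in the ellipsoid.\<close>
    have V: "ennreal (q * s powr (B $ i) * \<epsilon>) \<le> weighted_volume B \<Omega>"
    proof -
      define l u where "l = (\<chi> j. c $ j + \<eta> * D j)" and "u = (\<chi> j. c $ j + 2 * \<eta> * D j)"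
      have box_sub: "x \<in> \<Omega>" if "x \<in> cbox l u" for x
      proof -
        have "\<bar>T (x - c) $ j\<bar> \<le> 2 * \<eta>" for j
        proof -
          have "0 \<le> x $ j - c $ j" "x $ j - c $ j \<le> 2 * \<eta> * D j"
            using that mult_pos_pos[OF \<eta>(1) D(1)[of j]]
            by (auto simp: mem_box_cart l_def u_def algebra_simps dest!: spec[of _ j])
          then show ?thesis
            using D(1)[of j] by (simp add: T_def abs_of_nonneg pos_divide_le_eq)
        qed
        then have "(\<Sum>j\<in>UNIV. \<bar>T (x - c) $ j\<bar>) \<le> (\<Sum>j\<in>(UNIV :: 'n set). 2 * \<eta>)"
          by (intro sum_mono)
        then have "norm (T (x - c)) \<le> 1 / 2"
          using norm_le_l1_cart[of "T (x - c)"] by (simp add: \<eta>_def)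
        then show ?thesis
          by (simp add: \<Omega>_def)
      qed
      have lower: "\<eta> powr (\<Sum>j\<in>UNIV. B $ j) * s powr (B $ i) \<le> monomial_weight B x"
        if "x \<in> cbox l u" for x
        unfolding monomial_weight_scaled[OF \<eta>(1) s, of B i, symmetric]
      proof (rule monomial_weight_mono[OF B])
        fix j
        have "\<eta> * (if j = i then s else 1) \<le> l $ j"
          using mult_right_mono[OF \<eta>(2) t] by (simp add: l_def c_def D_def s_def distrib_left)
        also have "\<dots> \<le> x $ j"
          using that by (simp add: mem_box_cart)
        finally show "\<bar>(\<chi> j. \<eta> * (if j = i then s else 1)) $ j\<bar> \<le> \<bar>x $ j\<bar>"
          using \<eta>(1) s by (auto simp: abs_of_pos)
      qed
      have diff: "(u - l) \<bullet> axis j 1 = \<eta> * D j" for j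
        by (simp add: inner_axis l_def u_def)
      have "emeasure lborel (cbox l u) = ennreal (\<Prod>b\<in>Basis. (u - l) \<bullet> b)"
      proof (rule emeasure_lborel_cbox)
        fix b :: "real ^ 'n"
        assume "b \<in> Basis"
        then obtain j where "b = axis j 1"
          by (auto simp: Basis_vec_def)
        moreover have "0 \<le> \<eta> * D j"
          using \<eta>(1) D(1)[of j] by simp
        ultimately show "l \<bullet> b \<le> u \<bullet> b"
          using diff[of j] by (simp add: inner_diff_left)
      qed
      also have "(\<Prod>b\<in>Basis. (u - l) \<bullet> b) = (\<Prod>j\<in>UNIV. \<eta> * D j)"
        by (simp only: prod_Basis_vec diff)
      also have "\<dots> = \<eta> ^ CARD('n) * \<epsilon>"
        by (simp add: prod.distrib D_def)
      finally have box: "emeasure lborel (cbox l u) = ennreal (\<eta> ^ CARD('n) * \<epsilon>)" .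
      have "ennreal (q * s powr (B $ i) * \<epsilon>)
          = ennreal (\<eta> powr (\<Sum>j\<in>UNIV. B $ j) * s powr (B $ i)) * emeasure lborel (cbox l u)"
        unfolding box using \<eta> \<epsilon> by (subst ennreal_mult[symmetric]) (auto simp: q_def ac_simps)
      also have "\<dots> = (\<integral>\<^sup>+x. ennreal (\<eta> powr (\<Sum>j\<in>UNIV. B $ j) * s powr (B $ i))
          * indicator (cbox l u) x \<partial>lborel)"
        by (rule nn_integral_cmult_indicator[symmetric]) simp
      also have "\<dots> \<le> weighted_volume B \<Omega>"
        unfolding weighted_volume_def using box_sub lower
        by (intro nn_integral_mono) (auto simp: indicator_def intro!: ennreal_leI)
      finally show ?thesis .
    qed
    have v_pos: "0 < q * s powr (B $ i) * \<epsilon>"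
      using q s \<epsilon> by simp
    obtain v where v: "weighted_volume B \<Omega> = ennreal v" "q * s powr (B $ i) * \<epsilon> \<le> v" "0 < v"
      using V V_fin v_pos by (cases "weighted_volume B \<Omega>") (auto simp: ennreal_le_iff2)
    have "iso_constant A B \<le> weighted_perimeter A \<Omega> / ennreal (enn2real (weighted_volume B \<Omega>) powr r)"
      unfolding iso_constant_def r_def using smooth V_fin v by (intro INF_lower) auto
    also have "\<dots> \<le> ennreal (s powr (A $ i) * m0) / ennreal (v powr r)"
      using v by (simp add: divide_right_mono_ennreal[OF P])
    also have "\<dots> = ennreal (s powr (A $ i) * m0 / v powr r)"
      using v m0(1) by (intro divide_ennreal) auto
    also have "\<dots> \<le> ennreal (s powr (A $ i) * m0 / (q * s powr (B $ i) * \<epsilon>) powr r)"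
      using v v_pos m0(1) r by (intro ennreal_leI divide_left_mono powr_mono2 mult_pos_pos) (auto simp: r_def)
    also have "s powr (A $ i) * m0 / (q * s powr (B $ i) * \<epsilon>) powr r
        = m0 / q powr r * s powr (A $ i - r * B $ i) * \<epsilon> powr (- r)"
      using q s \<epsilon> by (simp add: powr_mult powr_powr powr_diff powr_minus field_simps)
    finally show ?thesis
      by (simp add: s_def)
  qed
  then show ?thesis
    unfolding r_def by (rule that)
qed

lemma eq_0_if_le_powr_decay:
  fixes X :: ennreal
  assumes e: "0 < e" and le: "\<And>s. 1 \<le> s \<Longrightarrow> X \<le> ennreal (M * s powr (- e))"
  shows "X = 0"
proof -
  have "((\<lambda>s. M * s powr (- e)) \<longlongrightarrow> M * 0) at_top"
    using e by (intro tendsto_intros tendsto_neg_powr filterlim_ident) auto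
  then have "((\<lambda>s. ennreal (M * s powr (- e))) \<longlongrightarrow> ennreal (M * 0)) at_top"
    by (rule tendsto_ennrealI)
  moreover have "eventually (\<lambda>s. X \<le> ennreal (M * s powr (- e))) at_top"
    using eventually_ge_at_top[of 1] by eventually_elim (rule le)
  ultimately have "X \<le> ennreal (M * 0)"
    by (intro tendsto_lowerbound) auto
  then show ?thesis
    by simp
qed

text \<open>Translating a ball along an axis excludes a negative difference \<open>a\<^sub>i - rb\<^sub>i\<close>; flattening a ball
  onto a coordinate hyperplane excludes a difference above r.\<close>

lemma iso_constant_pos_imp:
  fixes A B :: "real ^ 'n"
  assumes A: "\<And>j. 0 \<le> A $ j" and B: "\<And>j. 0 \<le> B $ j"
    and r: "0 \<le> iso_exponent A B" and pos: "0 < iso_constant A B"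
  shows "0 \<le> A $ i - iso_exponent A B * B $ i"
    and "A $ i - iso_exponent A B * B $ i \<le> iso_exponent A B"
proof -
  define r where "r = iso_exponent A B"
  define \<tau> where "\<tau> = A $ i - r * B $ i"
  obtain M where M: "\<And>t \<epsilon>. 0 \<le> t \<Longrightarrow> 0 < \<epsilon> \<Longrightarrow> \<epsilon> \<le> 1 \<Longrightarrow>
      iso_constant A B \<le> ennreal (M * (t + \<epsilon>) powr \<tau> * \<epsilon> powr (- r))"
    unfolding r_def \<tau>_def using iso_constant_le_ellipsoid[OF A B r] by blast
  have "0 \<le> \<tau>"
  proof (rule ccontr)
    assume "\<not> ?thesis"
    moreover have "iso_constant A B \<le> ennreal (M * s powr (- (- \<tau>)))" if "1 \<le> s" for s
      using M[of "s - 1" 1] that by simp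
    ultimately have "iso_constant A B = 0"
      by (intro eq_0_if_le_powr_decay[of "- \<tau>"]) auto
    with pos show False
      by simp
  qed
  moreover have "\<tau> \<le> r"
  proof (rule ccontr)
    assume "\<not> ?thesis"
    moreover have "iso_constant A B \<le> ennreal (M * s powr (- (\<tau> - r)))" if "1 \<le> s" for s
    proof -
      have "(1 / s) powr \<tau> * (1 / s) powr (- r) = s powr (- (\<tau> - r))"
        using that by (simp add: powr_divide powr_minus powr_diff field_simps)
      then show ?thesis
        using M[of 0 "1 / s"] that by (simp add: mult.assoc)
    qed
    ultimately have "iso_constant A B = 0"
      by (intro eq_0_if_le_powr_decay[of "\<tau> - r"]) auto
    with pos show False
      by simp
  qed
  ultimately show "0 \<le> A $ i - iso_exponent A B * B $ i"
    and "A $ i - iso_exponent A B * B $ i \<le> iso_exponent A B"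
    by (simp_all add: \<tau>_def r_def)
qed

section \<open>The characterization\<close>

text \<open>Here x and y are the i-th entries of A and B. The conditions compare x/y and x/(y+1) with the
  fraction (N+a-1)/(N+b). It is the mediant of x/y, respectively x/(y+1), and the fraction that
  remains after x is removed from its numerator and y, respectively y+1, from its denominator;
  so comparing with the remaining fraction amounts to the same.\<close>

lemma condition_equivalent:
  fixes N a b x y :: real
  assumes "2 \<le> N" "0 \<le> x" "x \<le> a" "0 \<le> y" "y \<le> b"
  shows "0 \<le> x - (N + a - 1) / (N + b) * y \<longleftrightarrow> 0 \<le> x - (N + (a - x) - 1) / (N + (b - y)) * y"
    and "x - (N + a - 1) / (N + b) * y \<le> (N + a - 1) / (N + b)
      \<longleftrightarrow> x / (y + 1) \<le> (N + (a - x) - 1) / (N + (b - y) - 1)"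
proof -
  have pos: "0 < N + b" "0 < N + (b - y)" "0 < N + (b - y) - 1" "0 < y + 1"
    using assms by auto
  have "0 \<le> x - (N + a - 1) / (N + b) * y \<longleftrightarrow> (N + a - 1) * y \<le> x * (N + b)"
    using pos(1) by (simp add: field_simps)
  moreover have "0 \<le> x - (N + (a - x) - 1) / (N + (b - y)) * y \<longleftrightarrow> (N + a - 1) * y \<le> x * (N + b)"
    using pos(2) by (simp add: pos_divide_le_eq) (simp add: algebra_simps)
  ultimately show "0 \<le> x - (N + a - 1) / (N + b) * y \<longleftrightarrow> 0 \<le> x - (N + (a - x) - 1) / (N + (b - y)) * y"
    by simp
  have "x - (N + a - 1) / (N + b) * y \<le> (N + a - 1) / (N + b) \<longleftrightarrow> x \<le> (N + a - 1) / (N + b) * (y + 1)"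
    unfolding distrib_left by linarith
  also have "\<dots> \<longleftrightarrow> x \<le> (N + a - 1) * (y + 1) / (N + b)"
    by simp
  also have "\<dots> \<longleftrightarrow> x * (N + b) \<le> (N + a - 1) * (y + 1)"
    using pos(1) by (rule pos_le_divide_eq)
  also have "\<dots> \<longleftrightarrow> x * (N + (b - y) - 1) \<le> (N + (a - x) - 1) * (y + 1)"
    by (simp add: algebra_simps)
  also have "\<dots> \<longleftrightarrow> x / (y + 1) \<le> (N + (a - x) - 1) / (N + (b - y) - 1)"
    using pos(3,4) by (simp add: divide_le_eq pos_le_divide_eq mult.commute)
  finally show "x - (N + a - 1) / (N + b) * y \<le> (N + a - 1) / (N + b)
      \<longleftrightarrow> x / (y + 1) \<le> (N + (a - x) - 1) / (N + (b - y) - 1)" .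
qed

theorem theorem1p1:
  fixes A B :: "real ^ 'n" and N a b :: real
  assumes dim: "CARD('n) \<ge> 2"
    and A_nonneg: "\<And>i. 0 \<le> A $ i"
    and B_nonneg: "\<And>i. 0 \<le> B $ i"
    and N_eq: "N = real CARD('n)"
    and a_eq: "a = (\<Sum>i\<in>UNIV. A $ i)"
    and b_eq: "b = (\<Sum>i\<in>UNIV. B $ i)"
  shows "(iso_constant A B > 0 \<longrightarrow>
          (\<forall>i. 0 \<le> A $ i - (N + a - 1) / (N + b) * B $ i \<and>
                A $ i - (N + a - 1) / (N + b) * B $ i \<le> (N + a - 1) / (N + b))) \<and>
         ((\<forall>i. 0 \<le> A $ i - (N + a - 1) / (N + b) * B $ i \<and>
                A $ i - (N + a - 1) / (N + b) * B $ i \<le> (N + a - 1) / (N + b)) \<longleftrightarrow>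
          (\<forall>i. 0 \<le> A $ i - (N + (a - A $ i) - 1) / (N + (b - B $ i)) * B $ i \<and>
                A $ i / (B $ i + 1) \<le> (N + (a - A $ i) - 1) / (N + (b - B $ i) - 1))) \<and>
         (a - b \<le> 1 \<and>
          (\<forall>i. 0 \<le> A $ i - (N + a - 1) / (N + b) * B $ i \<and>
                A $ i - (N + a - 1) / (N + b) * B $ i \<le> (N + a - 1) / (N + b)) \<longrightarrow>
          iso_constant A B > 0)"
proof (intro conjI)
  have exponent: "iso_exponent A B = (N + a - 1) / (N + b)"
    by (simp add: iso_exponent_def N_eq a_eq b_eq)
  have N: "2 \<le> N"
    using dim by (simp add: N_eq)
  have sums: "A $ i \<le> a" "B $ i \<le> b" for i
    unfolding a_eq b_eq using A_nonneg B_nonneg by (auto intro!: member_le_sum)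
  have nonneg: "0 \<le> a" "0 \<le> b"
    unfolding a_eq b_eq using A_nonneg B_nonneg by (auto intro!: sum_nonneg)
  have exponent_pos: "0 < iso_exponent A B"
    unfolding exponent using N nonneg by (intro divide_pos_pos) auto
  show "iso_constant A B > 0 \<longrightarrow>
      (\<forall>i. 0 \<le> A $ i - (N + a - 1) / (N + b) * B $ i \<and>
        A $ i - (N + a - 1) / (N + b) * B $ i \<le> (N + a - 1) / (N + b))"
    unfolding exponent[symmetric]
    using iso_constant_pos_imp[OF A_nonneg B_nonneg less_imp_le[OF exponent_pos]] by blast
  show "(\<forall>i. 0 \<le> A $ i - (N + a - 1) / (N + b) * B $ i \<and>
        A $ i - (N + a - 1) / (N + b) * B $ i \<le> (N + a - 1) / (N + b)) \<longleftrightarrow>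
      (\<forall>i. 0 \<le> A $ i - (N + (a - A $ i) - 1) / (N + (b - B $ i)) * B $ i \<and>
        A $ i / (B $ i + 1) \<le> (N + (a - A $ i) - 1) / (N + (b - B $ i) - 1))"
    using condition_equivalent[OF N A_nonneg sums(1) B_nonneg sums(2)] by simp
  show "a - b \<le> 1 \<and>
      (\<forall>i. 0 \<le> A $ i - (N + a - 1) / (N + b) * B $ i \<and>
        A $ i - (N + a - 1) / (N + b) * B $ i \<le> (N + a - 1) / (N + b)) \<longrightarrow>
      iso_constant A B > 0"
  proof
    assume *: "a - b \<le> 1 \<and>
      (\<forall>i. 0 \<le> A $ i - (N + a - 1) / (N + b) * B $ i \<and>
        A $ i - (N + a - 1) / (N + b) * B $ i \<le> (N + a - 1) / (N + b))"
    then have "iso_exponent A B \<le> 1"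
      unfolding exponent using N nonneg by (simp add: divide_le_eq)
    then show "iso_constant A B > 0"
      using * by (intro iso_constant_pos A_nonneg B_nonneg exponent_pos) (simp_all add: exponent)
  qed
qed

end
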